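(* Let $n$ and $k$ be positive integers such that $n\geq 2k^2+2k+1$ if $k\geq 2$, and $n\geq 10$ if $k=1$. If the residue of $n$ modulo $2k^2+2k+1$ lies in $\{1,2,\ldots,2k^2\}$, then $$\zeta_k(G_{n,n}) = \left\lceil\frac{n}{2k^2+2k+1}\right\rceil.$$ Otherwise, $$\zeta_k(G_{n,n}) \in \left\{\left\lceil\frac{n}{2k^2+2k+1}\right\rceil,\ \left\lceil\frac{n}{2k^2+2k+1}\right\rceil+1\right\}.$$
   Context: $G_{n,n}$ is the $n\times n$ Cartesian grid graph: its vertex set is $[n]\times[n]$ with $[n]=\{1,\dots,n\}$, and $(x,y)$ and $(x',y')$ are adjacent exactly when $|x-x'|+|y-y'|=1$. The $k$-visibility Localization game on a finite connected graph $G$ ($k\ge 0$ an integer) with $m$ cops: the robber first chooses a vertex of $G$. Then in each round the cops choose any vertices $u_1,\dots,u_m$ (no restriction relative to earlier placements), and cop $i$ receives the probe $d_i=d(u_i,x)$ if the robber's vertex $x$ satisfies $d(u_i,x)\le k$, and $d_i=\ast$ (no information) otherwise; afterwards the robber moves to a neighboring vertex or stays in place. A candidate is a vertex the robber may occupy, consistent with the information obtained so far. The cops win if they have a strategy that, whatever the robber does, determines after finitely many rounds a unique candidate (the robber is omniscient and knows the cops' entire strategy). The $k$-visibility localization number $\zeta_k(G)$ is the least positive integer $m$ for which $m$ cops have a winning strategy. *)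

theory Defs
  imports Complex_Main
begin

record 'a graph =
  verts :: "'a set"
  adj :: "'a \<Rightarrow> 'a \<Rightarrow> bool"

definition edge_rel :: "'a graph \<Rightarrow> ('a \<times> 'a) set" where
  "edge_rel G = {(u, v). u \<in> verts G \<and> v \<in> verts G \<and> adj G u v}"

(* Length of a shortest walk; only meaningful for u and v in the same connected component. *)
definition gdist :: "'a graph \<Rightarrow> 'a \<Rightarrow> 'a \<Rightarrow> nat" where
  "gdist G u v = (LEAST l. (u, v) \<in> edge_rel G ^^ l)"

definition grid_graph :: "nat \<Rightarrow> (nat \<times> nat) graph" where
  "grid_graph n =
    \<lparr>verts = {1..n} \<times> {1..n},
     adj = (\<lambda>(x, y) (x', y'). \<bar>int x - int x'\<bar> + \<bar>int y - int y'\<bar> = 1)\<rparr>"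

(* None is the answer "no information". *)
definition probe :: "'a graph \<Rightarrow> nat \<Rightarrow> 'a \<Rightarrow> 'a \<Rightarrow> nat option" where
  "probe G k u x = (if gdist G u x \<le> k then Some (gdist G u x) else None)"

(* A cop strategy maps the answers of all previous rounds (oldest first, one list entry
   per cop) to the list of cop positions of the current round. *)
type_synonym 'a strategy = "nat option list list \<Rightarrow> 'a list"

definition cop_strategy :: "'a graph \<Rightarrow> nat \<Rightarrow> 'a strategy \<Rightarrow> bool" where
  "cop_strategy G m \<sigma> \<longleftrightarrow> (\<forall>h. length (\<sigma> h) = m \<and> set (\<sigma> h) \<subseteq> verts G)"

(* r t is the position of the robber when the cops probe in round t, rounds counted from 0. *)
definition robber_walk :: "'a graph \<Rightarrow> (nat \<Rightarrow> 'a) \<Rightarrow> bool" where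
  "robber_walk G r \<longleftrightarrow>
    (\<forall>t. r t \<in> verts G) \<and> (\<forall>t. r (Suc t) = r t \<or> adj G (r t) (r (Suc t)))"

(* The answers received in the first t rounds. *)
fun history :: "'a graph \<Rightarrow> nat \<Rightarrow> 'a strategy \<Rightarrow> (nat \<Rightarrow> 'a) \<Rightarrow> nat \<Rightarrow> nat option list list" where
  "history G k \<sigma> r 0 = []"
| "history G k \<sigma> r (Suc t) =
    history G k \<sigma> r t @ [map (\<lambda>u. probe G k u (r t)) (\<sigma> (history G k \<sigma> r t))]"

(* The vertices the robber may occupy immediately after the probe of round t, i.e. before
   his next move, given all answers up to and including round t. *)
definition candidates :: "'a graph \<Rightarrow> nat \<Rightarrow> 'a strategy \<Rightarrow> (nat \<Rightarrow> 'a) \<Rightarrow> nat \<Rightarrow> 'a set" where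
  "candidates G k \<sigma> r t =
    {r' t | r'. robber_walk G r' \<and> history G k \<sigma> r' (Suc t) = history G k \<sigma> r (Suc t)}"

(* The robber knows the strategy, so it has to succeed against every robber walk. *)
definition cops_win :: "'a graph \<Rightarrow> nat \<Rightarrow> nat \<Rightarrow> bool" where
  "cops_win G k m \<longleftrightarrow>
    (\<exists>\<sigma>. cop_strategy G m \<sigma> \<and>
      (\<forall>r. robber_walk G r \<longrightarrow> (\<exists>t. \<exists>!v. v \<in> candidates G k \<sigma> r t)))"

definition localization_number :: "nat \<Rightarrow> 'a graph \<Rightarrow> nat" where
  "localization_number k G = (LEAST m. 0 < m \<and> cops_win G k m)"

end

theory Submission
  imports Defs
begin

text \<open>
  Write \<open>N = 2 k\<^sup>2 + 2 k + 1\<close> for the size of a ball of radius \<open>k\<close>.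

  If \<open>m N < n\<close>, the robber can avoid being seen at all. A set of \<open>n (n - 1) / 2\<close> vertices has at
  least \<open>n - 1\<close> outer neighbours, and the cops see at most \<open>n - 1\<close> vertices per round, so the set
  of positions an unseen robber may have never drops below \<open>n (n - 1) / 2\<close>.

  If \<open>m N > n + 2 k\<close>, the cops sweep the grid from left to right with the balls of a perfect tiling.
  The contaminated region moves left by one column per round; in the frame moving along with it,
  contamination is stationary, and \<open>n + 2 k\<close> balls are needed for every \<open>N\<close> columns, while the
  cops place \<open>m N\<close> balls in \<open>N\<close> rounds. So the robber is eventually seen. From then on a few
  cops localize him: in the coordinates \<open>x + y\<close>, \<open>x - y\<close> balls are squares, and two cops can
  confine the robber to smaller and smaller balls. The small cases are settled by explicit decision
  trees; for \<open>k = 2\<close> these leave pairs of diagonal neighbours, which are driven to the left side of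
  the grid.
\<close>

subsection \<open>Distances in the grid\<close>

text \<open>Integer coordinates avoid truncated subtraction and let cops and translations leave the
  grid.\<close>

definition zdist :: "int \<times> int \<Rightarrow> int \<times> int \<Rightarrow> int" where
  "zdist p q = \<bar>fst p - fst q\<bar> + \<bar>snd p - snd q\<bar>"

lemma zdist_Pair [simp]: "zdist (a, b) (c, d) = \<bar>a - c\<bar> + \<bar>b - d\<bar>"
  by (simp add: zdist_def)

lemma zdist_nonneg [simp]: "0 \<le> zdist p q"
  by (simp add: zdist_def)

lemma zdist_triangle: "zdist p r \<le> zdist p q + zdist q r"
  by (simp add: zdist_def)

lemma zdist_self [simp]: "zdist p p = 0"
  by (simp add: zdist_def)

lemma zdist_eq_0_iff [simp]: "zdist p q = 0 \<longleftrightarrow> p = q"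
  by (cases p; cases q) auto

definition zpt :: "nat \<times> nat \<Rightarrow> int \<times> int" where
  "zpt p = (int (fst p), int (snd p))"

lemma zpt_Pair [simp]: "zpt (a, b) = (int a, int b)"
  by (simp add: zpt_def)

lemma zpt_eq_iff [simp]: "zpt p = zpt q \<longleftrightarrow> p = q"
  by (cases p; cases q) simp

definition zbox :: "nat \<Rightarrow> (int \<times> int) set" where
  "zbox n = {1..int n} \<times> {1..int n}"

lemma zpt_in_zbox_iff [simp]: "zpt p \<in> zbox n \<longleftrightarrow> p \<in> verts (grid_graph n)"
  by (cases p) (auto simp: zbox_def grid_graph_def)

lemma adj_grid_graph: "adj (grid_graph n) p q \<longleftrightarrow> zdist (zpt p) (zpt q) = 1"
  by (cases p; cases q) (simp add: grid_graph_def)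

lemma zdist_le_of_walk:
  assumes "(p, q) \<in> edge_rel (grid_graph n) ^^ l"
  shows "zdist (zpt p) (zpt q) \<le> int l"
  using assms
proof (induction l arbitrary: q)
  case (Suc l)
  then obtain w where w: "(p, w) \<in> edge_rel (grid_graph n) ^^ l" "(w, q) \<in> edge_rel (grid_graph n)"
    by auto
  have "zdist (zpt w) (zpt q) = 1"
    using w(2) by (simp add: edge_rel_def adj_grid_graph)
  with Suc.IH[OF w(1)] zdist_triangle[of "zpt p" "zpt q" "zpt w"] show ?case by simp
qed simp

lemma walk_of_zdist:
  assumes "p \<in> verts (grid_graph n)" "q \<in> verts (grid_graph n)" "zdist (zpt p) (zpt q) = int l"
  shows "(p, q) \<in> edge_rel (grid_graph n) ^^ l"
  using assms
proof (induction l arbitrary: p)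
  case 0
  then show ?case by simp
next
  case (Suc l)
  obtain x y where p: "p = (x, y)" by (cases p)
  obtain x' y' where q: "q = (x', y')" by (cases q)
  \<comment> \<open>The walk is horizontal as long as possible; its coordinates stay between those
    of \<open>p\<close> and \<open>q\<close>, hence inside the grid.\<close>
  define w where "w = (if x < x' then (Suc x, y) else if x' < x then (x - 1, y)
    else if y < y' then (x, Suc y) else (x, y - 1))"
  have "w \<in> verts (grid_graph n) \<and> zdist (zpt p) (zpt w) = 1 \<and> zdist (zpt w) (zpt q) = int l"
    using Suc.prems unfolding p q w_def by (auto simp: grid_graph_def split: if_splits)
  then have "(p, w) \<in> edge_rel (grid_graph n)" "(w, q) \<in> edge_rel (grid_graph n) ^^ l"
    using Suc by (auto simp: edge_rel_def adj_grid_graph)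
  then show ?case by (rule relpow_Suc_I2)
qed

lemma gdist_grid_graph:
  assumes "p \<in> verts (grid_graph n)" "q \<in> verts (grid_graph n)"
  shows "int (gdist (grid_graph n) p q) = zdist (zpt p) (zpt q)"
proof -
  obtain l where l: "zdist (zpt p) (zpt q) = int l"
    by (metis zdist_nonneg nonneg_int_cases)
  have "gdist (grid_graph n) p q = l"
    unfolding gdist_def
  proof (rule Least_equality)
    show "(p, q) \<in> edge_rel (grid_graph n) ^^ l" by (rule walk_of_zdist[OF assms l])
    show "l \<le> i" if "(p, q) \<in> edge_rel (grid_graph n) ^^ i" for i
      using zdist_le_of_walk[OF that] l by simp
  qed
  with l show ?thesis by simp
qed

subsection \<open>The game on a region of the integer lattice\<close>

definition zprobe :: "nat \<Rightarrow> int \<times> int \<Rightarrow> int \<times> int \<Rightarrow> int option" where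
  "zprobe k u x = (if zdist u x \<le> int k then Some (zdist u x) else None)"

definition indist :: "nat \<Rightarrow> (int \<times> int) list \<Rightarrow> (int \<times> int) set \<Rightarrow> int \<times> int \<Rightarrow> (int \<times> int) set" where
  "indist k U C x = {y \<in> C. \<forall>u\<in>set U. zprobe k u y = zprobe k u x}"

definition reach :: "(int \<times> int) set \<Rightarrow> (int \<times> int) set \<Rightarrow> (int \<times> int) set" where
  "reach B C = {y \<in> B. \<exists>x\<in>C. zdist x y \<le> 1}"

lemma reach_mono: "B \<subseteq> B' \<Longrightarrow> C \<subseteq> C' \<Longrightarrow> reach B C \<subseteq> reach B' C'"
  unfolding reach_def by blast

text \<open>The robber is confined to \<open>B\<close> and is known to be in \<open>C\<close> at the moment of the next
  probe. The cops may stand anywhere in the lattice, also outside \<open>B\<close>.\<close>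

inductive localizable :: "(int \<times> int) set \<Rightarrow> nat \<Rightarrow> nat \<Rightarrow> (int \<times> int) set \<Rightarrow> bool" for B k m where
  step: "length U \<le> m \<Longrightarrow>
    (\<And>x. x \<in> C \<Longrightarrow> indist k U C x \<subseteq> {x} \<or> localizable B k m (reach B (indist k U C x))) \<Longrightarrow>
    localizable B k m C"

text \<open>The same probes work in the easier game: an answer with visibility \<open>k'\<close>
  determines the one with visibility \<open>k\<close>, so the sets of indistinguishable candidates
  only shrink.\<close>

lemma localizable_mono:
  assumes "localizable B k m C" "B' \<subseteq> B" "k \<le> k'" "m \<le> m'" "C' \<subseteq> C"
  shows "localizable B' k' m' C'"
  using assms(1,5)
proof (induction arbitrary: C')
  case (step U C)
  show ?case
  proof (rule localizable.step)
    show "length U \<le> m'" using step.hyps(1) assms(4) by simp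
    fix x assume x: "x \<in> C'"
    have sub: "indist k' U C' x \<subseteq> indist k U C x"
    proof
      fix y assume "y \<in> indist k' U C' x"
      then have y: "y \<in> C'" "\<And>u. u \<in> set U \<Longrightarrow> zprobe k' u y = zprobe k' u x"
        by (auto simp: indist_def)
      have "zprobe k u y = zprobe k u x" if "u \<in> set U" for u
        using y(2)[OF that] assms(3) by (auto simp: zprobe_def split: if_splits)
      with y(1) step.prems show "y \<in> indist k U C x" by (auto simp: indist_def)
    qed
    from x step.prems have "x \<in> C" by blast
    from step.IH[OF this] sub reach_mono[OF assms(2) sub]
    show "indist k' U C' x \<subseteq> {x} \<or> localizable B' k' m' (reach B' (indist k' U C' x))"
      by blast
  qed
qed

lemma localizable_empty: "localizable B k m {}"
  by (rule localizable.step[of "[]"]) auto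

definition zball :: "int \<Rightarrow> int \<times> int \<Rightarrow> (int \<times> int) set" where
  "zball r u = {x. zdist u x \<le> r}"

text \<open>Only contact within \<open>r\<close> is exploited: either one cop's measurement puts all
  candidates into the ball around it, or all these balls are cleared. Choosing \<open>r\<close>
  below \<open>k\<close> leaves a smaller ball after contact.\<close>

lemma localizable_blind:
  assumes "length U \<le> m" "r \<le> int k"
    and "\<And>u. u \<in> set U \<Longrightarrow> localizable B k m (reach B (zball r u))"
    and "localizable B k m (reach B {x \<in> C. \<forall>u\<in>set U. r < zdist u x})"
  shows "localizable B k m C"
proof (rule localizable.step[OF assms(1)], rule disjI2)
  fix x assume x: "x \<in> C"
  show "localizable B k m (reach B (indist k U C x))"
  proof (cases "\<exists>u\<in>set U. zdist u x \<le> r")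
    case True
    then obtain u where u: "u \<in> set U" "zdist u x \<le> r" by blast
    have "indist k U C x \<subseteq> zball r u"
    proof
      fix y assume "y \<in> indist k U C x"
      then have "zprobe k u y = zprobe k u x" using u(1) by (simp add: indist_def)
      then show "y \<in> zball r u" using u(2) assms(2)
        by (auto simp: zprobe_def zball_def split: if_splits)
    qed
    from reach_mono[OF order_refl this] show ?thesis
      by (rule localizable_mono[OF assms(3)[OF u(1)] order_refl order_refl order_refl])
  next
    case False
    have "indist k U C x \<subseteq> {x \<in> C. \<forall>u\<in>set U. r < zdist u x}"
    proof
      fix y assume "y \<in> indist k U C x"
      then have y: "y \<in> C" "\<And>u. u \<in> set U \<Longrightarrow> zprobe k u y = zprobe k u x" by (auto simp: indist_def)
      have "r < zdist u y" if "u \<in> set U" for u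
        using y(2)[OF that] False that assms(2) by (force simp: zprobe_def split: if_splits)
      with y(1) show "y \<in> {x \<in> C. \<forall>u\<in>set U. r < zdist u x}" by blast
    qed
    from reach_mono[OF order_refl this] show ?thesis
      by (rule localizable_mono[OF assms(4) order_refl order_refl order_refl])
  qed
qed

section \<open>Translation invariance\<close>

definition shift :: "int \<times> int \<Rightarrow> int \<times> int \<Rightarrow> int \<times> int" where
  "shift v p = (fst v + fst p, snd v + snd p)"

lemma zdist_shift [simp]: "zdist (shift v p) (shift v q) = zdist p q"
  by (simp add: zdist_def shift_def)

lemma shift_eq_iff [simp]: "shift v p = shift v q \<longleftrightarrow> p = q"
  by (cases p; cases q) (simp add: shift_def)

lemma zprobe_shift [simp]: "zprobe k (shift v u) (shift v x) = zprobe k u x"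
  by (simp add: zprobe_def)

lemma indist_shift: "indist k (map (shift v) U) (shift v ` C) (shift v x) = shift v ` indist k U C x"
  by (auto simp: indist_def)

lemma reach_shift: "reach (shift v ` B) (shift v ` C) = shift v ` reach B C"
  unfolding reach_def by (fastforce simp del: zdist_Pair)

lemma localizable_shift:
  assumes "localizable B k m C"
  shows "localizable (shift v ` B) k m (shift v ` C)"
  using assms
proof (induction)
  case (step U C)
  show ?case
  proof (rule localizable.step[of "map (shift v) U"])
    show "length (map (shift v) U) \<le> m" using step.hyps by simp
    fix x assume "x \<in> shift v ` C"
    then obtain z where z: "z \<in> C" "x = shift v z" by blast
    show "indist k (map (shift v) U) (shift v ` C) x \<subseteq> {x} \<or>
        localizable (shift v ` B) k m (reach (shift v ` B) (indist k (map (shift v) U) (shift v ` C) x))"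
      using step.IH[OF z(1)] unfolding z(2) indist_shift reach_shift by auto
  qed
qed

subsection \<open>From the lattice to the grid graph\<close>

definition clamp :: "nat \<Rightarrow> int \<times> int \<Rightarrow> nat \<times> nat" where
  "clamp n u = (nat (max 1 (min (int n) (fst u))), nat (max 1 (min (int n) (snd u))))"

lemma clamp_in_verts: "0 < n \<Longrightarrow> clamp n u \<in> verts (grid_graph n)"
  by (auto simp: clamp_def grid_graph_def)

text \<open>A cop outside the grid learns nothing more than its projection does.\<close>

lemma zdist_clamp:
  assumes "0 < n" "x \<in> zbox n"
  shows "zdist u x = zdist u (zpt (clamp n u)) + zdist (zpt (clamp n u)) x"
  using assms by (cases u; cases x) (auto simp: zbox_def clamp_def max_def min_def)

lemma zprobe_clamp_cong:
  assumes "0 < n" "x \<in> verts (grid_graph n)" "y \<in> verts (grid_graph n)"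
    and "probe (grid_graph n) k (clamp n u) x = probe (grid_graph n) k (clamp n u) y"
  shows "zprobe k u (zpt x) = zprobe k u (zpt y)"
proof -
  let ?c = "clamp n u"
  have c: "?c \<in> verts (grid_graph n)" using assms(1) by (rule clamp_in_verts)
  have d: "zdist u (zpt z) = zdist u (zpt ?c) + int (gdist (grid_graph n) ?c z)"
    if "z \<in> verts (grid_graph n)" for z
    using zdist_clamp[OF assms(1), of "zpt z" u] gdist_grid_graph[OF c that] that by simp
  let ?g = "gdist (grid_graph n) ?c"
  have "?g x = ?g y \<or> (k < ?g x \<and> k < ?g y)"
    using assms(4) by (auto simp: probe_def split: if_splits)
  then show ?thesis
  proof
    assume "k < ?g x \<and> k < ?g y"
    moreover have "0 \<le> zdist u (zpt ?c)" by simp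
    ultimately have "\<not> zdist u (zpt x) \<le> int k" "\<not> zdist u (zpt y) \<le> int k"
      unfolding d[OF assms(2)] d[OF assms(3)] by linarith+
    then show ?thesis by (simp add: zprobe_def)
  qed (simp add: zprobe_def d assms)
qed

text \<open>\<open>history\<close> grows at its end, whereas induction on \<open>localizable\<close>
  splits off the first round; the rest is played by a strategy that remembers the first
  answers.\<close>

lemma history_Cons:
  "history G k \<sigma> r (Suc t) =
    map (\<lambda>u. probe G k u (r 0)) (\<sigma> []) #
      history G k (\<lambda>h. \<sigma> (map (\<lambda>u. probe G k u (r 0)) (\<sigma> []) # h)) (\<lambda>i. r (Suc i)) t"
  by (induction t) auto

lemma robber_walk_Suc: "robber_walk G r \<Longrightarrow> robber_walk G (\<lambda>i. r (Suc i))"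
  by (auto simp: robber_walk_def)

text \<open>Comparing pairs of walks with equal histories is a form that passes to the tails of the
  walks. The cops play \<open>U\<close> and then follow the strategy that the induction supplies for
  the answers received.\<close>

lemma localizable_imp_strategy:
  assumes "localizable (zbox n) k m C" and n: "0 < n"
  shows "\<exists>\<sigma>. cop_strategy (grid_graph n) m \<sigma> \<and>
    (\<forall>r. robber_walk (grid_graph n) r \<and> zpt (r 0) \<in> C \<longrightarrow>
      (\<exists>t. \<forall>r'. robber_walk (grid_graph n) r' \<and> zpt (r' 0) \<in> C \<and>
        history (grid_graph n) k \<sigma> r' (Suc t) = history (grid_graph n) k \<sigma> r (Suc t) \<longrightarrow>
        r' t = r t))"
  using assms(1)
proof induction
  case (step U C)
  let ?G = "grid_graph n" and ?B = "zbox n"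
  define win where "win D \<sigma> \<longleftrightarrow> cop_strategy ?G m \<sigma> \<and>
    (\<forall>r. robber_walk ?G r \<and> zpt (r 0) \<in> D \<longrightarrow>
      (\<exists>t. \<forall>r'. robber_walk ?G r' \<and> zpt (r' 0) \<in> D \<and>
        history ?G k \<sigma> r' (Suc t) = history ?G k \<sigma> r (Suc t) \<longrightarrow> r' t = r t))" for D \<sigma>
  \<comment> \<open>A strategy places exactly \<open>m\<close> cops on vertices, so \<open>U\<close>
    is projected to the grid and padded with a corner.\<close>
  define V where "V = map (clamp n) U @ replicate (m - length U) (1, 1)"
  have "(1, 1) \<in> verts ?G" using n by (simp add: grid_graph_def)
  then have V: "length V = m" "set V \<subseteq> verts ?G"
    using step.hyps(1) clamp_in_verts[OF n] by (auto simp: V_def)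
  define ans where "ans x = map (\<lambda>u. probe ?G k u x) V" for x
  have indist: "zpt y \<in> indist k U C (zpt x)"
    if "ans y = ans x" "x \<in> verts ?G" "y \<in> verts ?G" "zpt y \<in> C" for x y
    using that zprobe_clamp_cong[OF n that(3,2)] by (auto simp: ans_def V_def indist_def)
  \<comment> \<open>Legal positions are due even after answers that no candidate gives or that
    already identify the robber.\<close>
  define default where "default = (\<lambda>_ :: nat option list list. V)"
  have dflt: "cop_strategy ?G m default" using V by (simp add: default_def cop_strategy_def)
  \<comment> \<open>The cops know only the answers, so the induction hypothesis is used for a chosen
    candidate producing them instead of the robber's actual position.\<close>
  define rep where "rep a = (SOME x. x \<in> verts ?G \<and> zpt x \<in> C \<and> ans x = a)" for a
  define cont where "cont x = (SOME \<tau>. win (reach ?B (indist k U C x)) \<tau>)" for x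
  define sub where "sub a = (let x = zpt (rep a) in
    if x \<in> C \<and> \<not> indist k U C x \<subseteq> {x} then cont x else default)" for a
  have nxt: "win (reach ?B (indist k U C x)) (cont x)" if "x \<in> C" "\<not> indist k U C x \<subseteq> {x}" for x
    using step.IH[OF that(1)] that(2) unfolding cont_def win_def[symmetric]
    by (intro someI_ex[of "win _"]) blast
  define \<sigma> where "\<sigma> h = (case h of [] \<Rightarrow> V | a # h' \<Rightarrow> sub a h')" for h
  have "cop_strategy ?G m (sub a)" for a
    using nxt dflt by (auto simp: sub_def Let_def win_def)
  then have strat: "cop_strategy ?G m \<sigma>"
    using V by (auto simp: \<sigma>_def cop_strategy_def split: list.splits)
  have hist: "history ?G k \<sigma> r (Suc t) = ans (r 0) # history ?G k (sub (ans (r 0))) (\<lambda>i. r (Suc i)) t" for r t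
    unfolding history_Cons by (simp add: \<sigma>_def ans_def)
  have "\<exists>t. \<forall>r'. robber_walk ?G r' \<and> zpt (r' 0) \<in> C \<and>
      history ?G k \<sigma> r' (Suc t) = history ?G k \<sigma> r (Suc t) \<longrightarrow> r' t = r t"
    if r: "robber_walk ?G r" "zpt (r 0) \<in> C" for r
  proof -
    have r0: "r 0 \<in> verts ?G" using r(1) by (simp add: robber_walk_def)
    define x where "x = rep (ans (r 0))"
    have x: "x \<in> verts ?G" "zpt x \<in> C" "ans x = ans (r 0)"
      using someI[of "\<lambda>x. x \<in> verts ?G \<and> zpt x \<in> C \<and> ans x = ans (r 0)", OF conjI[OF r0 conjI[OF r(2) refl]]]
      unfolding x_def rep_def by auto
    have in_indist: "zpt (r' 0) \<in> indist k U C (zpt x)"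
      if "robber_walk ?G r'" "zpt (r' 0) \<in> C" "ans (r' 0) = ans (r 0)" for r'
      using that indist[of "r' 0" x] x by (simp add: robber_walk_def)
    show ?thesis
    proof (cases "indist k U C (zpt x) \<subseteq> {zpt x}")
      case True
      have "r' 0 = r 0" if "robber_walk ?G r'" "zpt (r' 0) \<in> C"
        "history ?G k \<sigma> r' (Suc 0) = history ?G k \<sigma> r (Suc 0)" for r'
      proof -
        have a: "ans (r' 0) = ans (r 0)" using that(3) unfolding hist by simp
        have "zpt (r' 0) = zpt x" "zpt (r 0) = zpt x"
          using subsetD[OF True in_indist[OF that(1,2) a]] subsetD[OF True in_indist[OF r refl]]
          by simp_all
        then show ?thesis by simp
      qed
      then show ?thesis by blast
    next
      case False
      have sub: "sub (ans (r 0)) = cont (zpt x)"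
        using False x(2) by (simp add: sub_def x_def Let_def)
      have w: "win (reach ?B (indist k U C (zpt x))) (sub (ans (r 0)))"
        unfolding sub using nxt x(2) False by blast
      have in_reach: "zpt (r' (Suc 0)) \<in> reach ?B (indist k U C (zpt x))"
        if "robber_walk ?G r'" "zpt (r' 0) \<in> C" "ans (r' 0) = ans (r 0)" for r'
      proof -
        have "r' (Suc 0) \<in> verts ?G" "r' (Suc 0) = r' 0 \<or> adj ?G (r' 0) (r' (Suc 0))"
          using that(1) unfolding robber_walk_def by blast+
        then show ?thesis
          using in_indist[OF that] by (auto simp: reach_def adj_grid_graph intro!: bexI[of _ "zpt (r' 0)"])
      qed
      obtain t where t: "\<And>r'. robber_walk ?G r' \<Longrightarrow> zpt (r' 0) \<in> reach ?B (indist k U C (zpt x)) \<Longrightarrow>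
          history ?G k (sub (ans (r 0))) r' (Suc t) =
            history ?G k (sub (ans (r 0))) (\<lambda>i. r (Suc i)) (Suc t) \<Longrightarrow> r' t = r (Suc t)"
        using w robber_walk_Suc[OF r(1)] in_reach[OF r refl] unfolding win_def by blast
      have "r' (Suc t) = r (Suc t)" if "robber_walk ?G r'" "zpt (r' 0) \<in> C"
        "history ?G k \<sigma> r' (Suc (Suc t)) = history ?G k \<sigma> r (Suc (Suc t))" for r'
      proof -
        have a: "ans (r' 0) = ans (r 0)" using that(3) unfolding hist by simp
        have "history ?G k (sub (ans (r 0))) (\<lambda>i. r' (Suc i)) (Suc t) =
            history ?G k (sub (ans (r 0))) (\<lambda>i. r (Suc i)) (Suc t)"
          using that(3) a unfolding hist by (simp only: list.inject)
        with t[OF robber_walk_Suc[OF that(1)]] in_reach[OF that(1,2) a] show ?thesis by blast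
      qed
      then show ?thesis by blast
    qed
  qed
  with strat show ?case by blast
qed

lemma cops_win_if_localizable:
  assumes "localizable (zbox n) k m (zbox n)" "0 < n"
  shows "cops_win (grid_graph n) k m"
proof -
  let ?G = "grid_graph n"
  obtain \<sigma> where s: "cop_strategy ?G m \<sigma>"
    and w: "\<And>r. robber_walk ?G r \<and> zpt (r 0) \<in> zbox n \<Longrightarrow>
      \<exists>t. \<forall>r'. robber_walk ?G r' \<and> zpt (r' 0) \<in> zbox n \<and>
        history ?G k \<sigma> r' (Suc t) = history ?G k \<sigma> r (Suc t) \<longrightarrow> r' t = r t"
    using localizable_imp_strategy[OF assms] by blast
  have "\<exists>t. \<exists>!v. v \<in> candidates ?G k \<sigma> r t" if r: "robber_walk ?G r" for r
  proof -
    have in_box: "zpt (r' 0) \<in> zbox n" if "robber_walk ?G r'" for r'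
      using that by (simp add: robber_walk_def)
    obtain t where "\<And>r'. robber_walk ?G r' \<Longrightarrow>
        history ?G k \<sigma> r' (Suc t) = history ?G k \<sigma> r (Suc t) \<Longrightarrow> r' t = r t"
      using w[of r] r in_box by blast
    then have "candidates ?G k \<sigma> r t = {r t}"
      using r unfolding candidates_def by blast
    then show ?thesis by (intro exI[of _ t]) auto
  qed
  with s show ?thesis unfolding cops_win_def by blast
qed

subsection \<open>Vertex expansion in the grid\<close>

text \<open>\<open>Q\<close>, its converse and the diagonal are pairwise disjoint subsets of
  \<open>A \<times> A\<close>.\<close>

lemma card_asym_le:
  assumes "finite A" "Q \<subseteq> A \<times> A" "Q \<inter> Q\<inverse> = {}"
  shows "2 * card Q + card A \<le> card A * card A"
proof -
  have fQ: "finite Q" using assms finite_subset by blast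
  have d: "Q \<inter> Q\<inverse> = {}" "(Q \<union> Q\<inverse>) \<inter> Id_on A = {}" using assms(3) by auto
  have "card (Q \<union> Q\<inverse> \<union> Id_on A) = card Q + card (Q\<inverse>) + card (Id_on A)"
    using fQ assms(1) d by (subst card_Un_disjoint; simp add: card_Un_disjoint Id_on_def)
  moreover have "Q \<union> Q\<inverse> \<union> Id_on A \<subseteq> A \<times> A" using assms(2) by auto
  then have "card (Q \<union> Q\<inverse> \<union> Id_on A) \<le> card A * card A"
    using assms(1) by (metis card_mono card_cartesian_product finite_cartesian_product)
  moreover have "card (Id_on A) = card A"
  proof -
    have "Id_on A = (\<lambda>x. (x, x)) ` A" by auto
    then show ?thesis by (simp add: card_image inj_on_def)
  qed
  ultimately show ?thesis by simp
qed

text \<open>Going from \<open>i\<close> to \<open>j\<close>, an increase between adjacent columns is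
  charged to the left one, a decrease to the right one; in either direction no column is charged
  twice.\<close>

lemma chain_bound:
  fixes s e :: "nat \<Rightarrow> int"
  assumes "i \<le> j" "\<And>l. 0 \<le> e l"
    and "\<And>l. i \<le> l \<Longrightarrow> l < j \<Longrightarrow> s (Suc l) \<le> s l + e l \<and> s l \<le> s (Suc l) + e (Suc l)"
  shows "\<bar>s i - s j\<bar> \<le> sum e {i..j}"
proof -
  have "s j \<le> s i + sum e {i..<j} \<and> s i \<le> s j + sum e {Suc i..j}"
    using assms(1,3)
  proof (induction j rule: dec_induct)
    case (step l)
    have "s (Suc l) \<le> s l + e l" "s l \<le> s (Suc l) + e (Suc l)" using step.prems[of l] step.hyps by auto
    moreover have "s l \<le> s i + sum e {i..<l} \<and> s i \<le> s l + sum e {Suc i..l}"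
      using step.IH step.prems by auto
    moreover have "sum e {Suc i..Suc l} = sum e {Suc i..l} + e (Suc l)"
      using step.hyps by simp
    ultimately show ?case using step.hyps by simp
  qed simp
  moreover have "sum e {i..<j} \<le> sum e {i..j}" "sum e {Suc i..j} \<le> sum e {i..j}"
    using assms(2) by (intro sum_mono2; auto)+
  ultimately show ?thesis by linarith
qed

text \<open>The positive columns other than those on the way from \<open>q\<close> to \<open>i\<close> each contribute at least
  one to \<open>E\<close>, in addition to the \<open>c i\<close> from the way itself. Being on the way to another
  column is an antisymmetric relation, so at most about half of all pairs are excluded.\<close>

lemma profile_bound:
  fixes c e :: "nat \<Rightarrow> int" and n :: nat
  assumes "finite I" "q \<in> I" "c q = 0" "\<And>i. 0 \<le> c i" "\<And>i. 0 \<le> e i"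
    and e1: "\<And>i. i \<in> I \<Longrightarrow> 0 < c i \<Longrightarrow> 1 \<le> e i"
    and chain: "\<And>i. i \<in> I \<Longrightarrow> c i \<le> sum e {min q i..max q i}"
    and I: "I = {1..n}"
  shows "2 * sum c I \<le> (sum e I)\<^sup>2 + sum e I"
proof -
  define A where "A = {i \<in> I. 0 < c i}"
  define way where "way i = {min q i..max q i}" for i
  define E where "E = sum e I"
  have fA: "finite A" using assms(1) by (simp add: A_def)
  have way_I: "way i \<subseteq> I" if "i \<in> I" for i
    using that assms(2) unfolding I way_def by auto
  have q: "q \<notin> A" using assms(3) by (simp add: A_def)
  have le: "c i + int (card (A - way i)) \<le> E" if "i \<in> I" for i
  proof -
    have "int (card (A - way i)) = (\<Sum>j\<in>A - way i. 1)" by simp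
    also have "\<dots> \<le> sum e (A - way i)" using e1 by (intro sum_mono) (auto simp: A_def)
    finally have "c i + int (card (A - way i)) \<le> sum e (way i) + sum e (A - way i)"
      using chain[OF that] by (simp add: way_def)
    also have "\<dots> = sum e (way i \<union> (A - way i))"
      using fA by (intro sum.union_disjoint[symmetric]) (auto simp: way_def)
    also have "\<dots> \<le> E"
      unfolding E_def using assms(1,5) way_I[OF that] by (intro sum_mono2) (auto simp: A_def)
    finally show ?thesis .
  qed
  define Q where "Q = {(i, j). i \<in> A \<and> j \<in> A \<and> j \<in> way i \<and> i \<noteq> j}"
  have Qs: "Q \<subseteq> A \<times> A" by (auto simp: Q_def)
  have "Q \<inter> Q\<inverse> = {}"
  proof -
    \<comment> \<open>Two columns other than \<open>q\<close>, each on the way to the other, lie on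
      the same side of \<open>q\<close> at the same distance.\<close>
    have "False" if "(i, j) \<in> Q" "(j, i) \<in> Q" for i j
    proof -
      have "i \<noteq> q" "j \<noteq> q" using that q by (auto simp: Q_def)
      with that show False unfolding Q_def way_def by (auto simp: min_def max_def split: if_splits)
    qed
    then show ?thesis by auto
  qed
  from card_asym_le[OF fA Qs this] have Q: "2 * card Q + card A \<le> card A * card A" .
  have part: "card A \<le> card (A - way i) + card {j. (i, j) \<in> Q} + 1" if "i \<in> A" for i
  proof -
    have fin: "finite {j. (i, j) \<in> Q}" using fA by (auto simp: Q_def intro: finite_subset[of _ A])
    have "A \<subseteq> (A - way i) \<union> {j. (i, j) \<in> Q} \<union> {i}" using that by (auto simp: Q_def)
    then have "card A \<le> card ((A - way i) \<union> {j. (i, j) \<in> Q} \<union> {i})"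
      using fA fin by (intro card_mono) auto
    also have "\<dots> \<le> card ((A - way i) \<union> {j. (i, j) \<in> Q}) + card {i}" by (rule card_Un_le)
    also have "\<dots> \<le> card (A - way i) + card {j. (i, j) \<in> Q} + card {i}"
      using card_Un_le[of "A - way i" "{j. (i, j) \<in> Q}"] by simp
    finally show ?thesis by simp
  qed
  have cQ: "(\<Sum>i\<in>A. card {j. (i, j) \<in> Q}) = card Q"
  proof -
    have "Q = Sigma A (\<lambda>i. {j. (i, j) \<in> Q})" using Qs by auto
    then have "card Q = card (Sigma A (\<lambda>i. {j. (i, j) \<in> Q}))" by simp
    also have "\<dots> = (\<Sum>i\<in>A. card {j. (i, j) \<in> Q})"
      using fA by (intro card_SigmaI) (auto simp: Q_def intro: finite_subset[of _ A])
    finally show ?thesis by simp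
  qed
  have "sum c I = sum c A"
    using assms(1,4) by (intro sum.mono_neutral_right) (auto simp: A_def order_le_less)
  also have "\<dots> \<le> (\<Sum>i\<in>A. E + int (card {j. (i, j) \<in> Q}) + 1 - int (card A))"
  proof (rule sum_mono)
    fix i assume i: "i \<in> A"
    then show "c i \<le> E + int (card {j. (i, j) \<in> Q}) + 1 - int (card A)"
      using le[of i] part[OF i] by (auto simp: A_def)
  qed
  also have "\<dots> = int (card A) * (E + 1 - int (card A)) + int (card Q)"
    by (simp add: sum.distrib sum_subtractf algebra_simps flip: cQ)
  finally have "2 * sum c I \<le> 2 * int (card A) * (E + 1 - int (card A)) + 2 * int (card Q)"
    by simp
  also have "\<dots> \<le> 2 * int (card A) * (E + 1 - int (card A)) + (int (card A) * int (card A) - int (card A))"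
  proof -
    have "int (2 * card Q + card A) \<le> int (card A * card A)" using Q by (subst of_nat_le_iff)
    then show ?thesis by simp
  qed
  \<comment> \<open>The subtracted term is a product of consecutive integers and therefore
    nonnegative.\<close>
  also have "\<dots> = E\<^sup>2 + E - (E - int (card A)) * (E - int (card A) + 1)"
    by (simp add: power2_eq_square algebra_simps)
  also have "\<dots> \<le> E\<^sup>2 + E"
  proof -
    have "0 \<le> x * (x + 1)" for x :: int unfolding zero_le_mult_iff by arith
    then show ?thesis by simp
  qed
  finally show ?thesis unfolding E_def .
qed


section \<open>Growth of a set of \<open>n * (n - 1) / 2\<close> vertices\<close>

definition gnbhd :: "nat \<Rightarrow> (nat \<times> nat) set \<Rightarrow> (nat \<times> nat) set" where
  "gnbhd n S = {y \<in> verts (grid_graph n). \<exists>x\<in>S. y = x \<or> adj (grid_graph n) x y}"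

lemma finite_verts_grid_graph [simp]: "finite (verts (grid_graph n))"
  by (simp add: grid_graph_def)

lemma card_verts_grid_graph: "card (verts (grid_graph n)) = n * n"
  by (simp add: grid_graph_def)

lemma interval_boundary:
  assumes "C \<subseteq> {1..n}" "C \<noteq> {}" "C \<noteq> {1..n}"
  obtains y z :: nat where "y \<in> C" "z \<in> {1..n} - C" "z = Suc y \<or> y = Suc z"
proof (rule ccontr)
  assume "\<not> thesis"
  with that have closed: "z \<in> C" if "y \<in> C" "z \<in> {1..n}" "z = Suc y \<or> y = Suc z" for y z
    using that by blast
  obtain y0 where y0: "y0 \<in> C" using assms(2) by blast
  have up: "z \<in> C" if "y0 \<le> z" "z \<le> n" for z
    using that
  proof (induction z rule: dec_induct)
    case (step z)
    then have "z \<in> C" by simp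
    with closed[of z "Suc z"] step.prems show ?case by simp
  qed (rule y0)
  have down: "z \<in> C" if "z \<le> y0" "1 \<le> z" for z
    using that
  proof (induction z rule: inc_induct)
    case (step z)
    then have "Suc z \<in> C" by simp
    with closed[of "Suc z" z] assms(1) step show ?case by auto
  qed (rule y0)
  have "{1..n} \<subseteq> C" using up down by (meson atLeastAtMost_iff linear subsetI)
  with assms show False by blast
qed

text \<open>Let \<open>e i\<close> count the new vertices in column \<open>i\<close>. If they sum to
  at most \<open>n - 2\<close>, some column gains none and is empty or full. The column sizes, or
  their complements, then satisfy \<open>profile_bound\<close>, which makes \<open>S\<close> or its
  complement too small.\<close>

lemma card_gnbhd_ge:
  assumes S: "S \<subseteq> verts (grid_graph n)" and half: "2 * card S = n * (n - 1)"
  shows "card S + (n - 1) \<le> card (gnbhd n S)"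
proof (rule ccontr)
  assume small: "\<not> ?thesis"
  define col where "col X i = {y. (i, y) \<in> X}" for X :: "(nat \<times> nat) set" and i
  define N where "N = gnbhd n S"
  define I where "I = {1..n}"
  have N: "N \<subseteq> verts (grid_graph n)" "S \<subseteq> N" using S by (auto simp: N_def gnbhd_def)
  have col_sub: "col X i \<subseteq> {1..n}" if "X \<subseteq> verts (grid_graph n)" for X i
    using that by (auto simp: col_def grid_graph_def)
  have fin: "finite (col X i)" if "X \<subseteq> verts (grid_graph n)" for X i
    using col_sub[OF that] finite_subset by blast
  have card_col: "card X = (\<Sum>i\<in>I. card (col X i))" if "X \<subseteq> verts (grid_graph n)" for X
  proof -
    have "X = Sigma I (col X)" using that by (auto simp: col_def I_def grid_graph_def)
    then have "card X = card (Sigma I (col X))" by simp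
    also have "\<dots> = (\<Sum>i\<in>I. card (col X i))"
      using fin[OF that] by (intro card_SigmaI) (auto simp: I_def)
    finally show ?thesis .
  qed
  define s where "s i = int (card (col S i))" for i
  define e where "e i = int (card (col N i)) - s i" for i
  have colS: "col S i \<subseteq> col N i" for i using N(2) by (auto simp: col_def)
  have e0: "0 \<le> e i" for i
    using card_mono[OF fin[OF N(1)] colS] by (simp add: e_def s_def)
  have s0: "0 \<le> s i" for i by (simp add: s_def)
  have sn: "s i \<le> int n" for i
    using card_mono[OF _ col_sub[OF S, of i]] by (simp add: s_def)
  have sumS: "sum s I = int (card S)" unfolding card_col[OF S] s_def by simp
  define E where "E = sum e I"
  have "E = int (card N) - int (card S)"
    unfolding E_def e_def sum_subtractf sumS card_col[OF N(1)] by simp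
  moreover have "int (card N) < int (card S) + int (n - 1)" using small unfolding N_def by linarith
  moreover have "0 \<le> E" unfolding E_def using e0 by (simp add: sum_nonneg)
  ultimately have E: "E \<le> int n - 2" "0 \<le> E" by linarith+
  have e1: "1 \<le> e i" if i: "i \<in> I" and si: "0 < s i" "s i < int n" for i
  proof -
    have "col S i \<noteq> {}" "col S i \<noteq> {1..n}" using si by (auto simp: s_def)
    then obtain y z where yz: "y \<in> col S i" "z \<in> {1..n} - col S i" "z = Suc y \<or> y = Suc z"
      using interval_boundary[OF col_sub[OF S]] by blast
    have "(i, z) \<in> N"
      using yz i unfolding N_def gnbhd_def
      by (auto simp: col_def grid_graph_def I_def intro!: bexI[of _ "(i, y)"])
    then have "insert z (col S i) \<subseteq> col N i" using colS by (auto simp: col_def)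
    then have "card (insert z (col S i)) \<le> card (col N i)" using fin[OF N(1)] by (intro card_mono)
    with yz(2) fin[OF S] show ?thesis by (simp add: e_def s_def)
  qed
  \<comment> \<open>The set \<open>N\<close> contains a horizontal copy of each column of
    \<open>S\<close> in the columns next to it.\<close>
  have side: "s j \<le> s i + e i" if "i \<in> I" "j \<in> I" "j = Suc i \<or> i = Suc j" for i j
  proof -
    have "col S j \<subseteq> col N i"
    proof
      fix y assume y: "y \<in> col S j"
      then have "y \<in> {1..n}" using col_sub[OF S] by blast
      then show "y \<in> col N i"
        using y that unfolding N_def gnbhd_def
        by (auto simp: col_def grid_graph_def I_def intro!: bexI[of _ "(j, y)"])
    qed
    from card_mono[OF fin[OF N(1)] this] show ?thesis by (simp add: e_def s_def)
  qed
  have chain_le: "\<bar>s i - s j\<bar> \<le> sum e {i..j}" if "i \<in> I" "j \<in> I" "i \<le> j" for i j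
  proof (rule chain_bound[OF that(3) e0])
    fix l assume "i \<le> l" "l < j"
    then have "l \<in> I" "Suc l \<in> I" using that by (auto simp: I_def)
    then show "s (Suc l) \<le> s l + e l \<and> s l \<le> s (Suc l) + e (Suc l)" using side by blast
  qed
  have chain: "\<bar>s q - s i\<bar> \<le> sum e {min q i..max q i}" if "i \<in> I" "q \<in> I" for i q
    using chain_le[OF that] chain_le[OF that(2,1)] by (cases "i \<le> q") (auto simp: min_def max_def)
  have far: "\<bar>s q - s i\<bar> \<le> E" if "i \<in> I" "q \<in> I" for i q
  proof -
    have "sum e {min q i..max q i} \<le> E"
      unfolding E_def using that e0 by (intro sum_mono2) (auto simp: I_def)
    with chain[OF that] show ?thesis by simp
  qed
  \<comment> \<open>Column sizes differ by at most \<open>E < n\<close>, so empty and full columns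
    do not coexist; every nonempty column is therefore proper in one case below, every non-full one
    in the other.\<close>
  have no_0n: False if "p \<in> I" "q \<in> I" "s p = 0" "s q = int n" for p q
    using far[OF that(1,2)] that(3,4) E by simp
  have EE: "E\<^sup>2 + E < int n * (int n - 1)"
  proof -
    have "E * (E + 1) \<le> (int n - 2) * (int n - 1)" using E by (intro mult_mono) auto
    also have "\<dots> < int n * (int n - 1)" using E by (intro mult_strict_right_mono) auto
    finally show ?thesis by (simp add: power2_eq_square algebra_simps)
  qed
  have half': "2 * int (card S) = int n * (int n - 1)"
  proof -
    have "int (2 * card S) = int (n * (n - 1))" using half by simp
    then show ?thesis using E by (simp add: of_nat_diff)
  qed
  have "\<exists>q\<in>I. s q = 0 \<or> s q = int n"
  proof (rule ccontr)
    assume "\<not> ?thesis"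
    then have "1 \<le> e i" if "i \<in> I" for i
      using e1[OF that] s0[of i] sn[of i] that by fastforce
    then have "(\<Sum>i\<in>I. 1) \<le> E" unfolding E_def by (intro sum_mono)
    then show False using E by (simp add: I_def)
  qed
  then obtain q where q: "q \<in> I" "s q = 0 \<or> s q = int n" by blast
  from q(2) show False
  proof
    assume sq: "s q = 0"
    have "2 * sum s I \<le> (sum e I)\<^sup>2 + sum e I"
    proof (rule profile_bound[where q = q and n = n])
      fix i assume i: "i \<in> I"
      show "s i \<le> sum e {min q i..max q i}" using chain[OF i q(1)] sq by simp
      assume "0 < s i"
      moreover have "s i \<noteq> int n" using no_0n[OF q(1) i sq] by blast
      ultimately show "1 \<le> e i" using e1[OF i] sn[of i] by simp
    qed (use q sq s0 e0 in \<open>auto simp: I_def\<close>)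
    with EE half' show False unfolding sumS E_def by simp
  next
    assume sq: "s q = int n"
    have "2 * (\<Sum>i\<in>I. int n - s i) \<le> (sum e I)\<^sup>2 + sum e I"
    proof (rule profile_bound[where q = q and n = n])
      fix i assume i: "i \<in> I"
      show "int n - s i \<le> sum e {min q i..max q i}" using chain[OF i q(1)] sq by simp
      assume "0 < int n - s i"
      moreover have "s i \<noteq> 0" using no_0n[OF i q(1) _ sq] by blast
      ultimately show "1 \<le> e i" using e1[OF i] s0[of i] by simp
    qed (use q sq sn e0 in \<open>auto simp: I_def\<close>)
    \<comment> \<open>The complement has \<open>n * (n + 1) / 2\<close> vertices, even more than
      \<open>S\<close>, so the same bound fails.\<close>
    moreover have "(\<Sum>i\<in>I. int n - s i) = int n * int n - int (card S)"
      unfolding sum_subtractf sumS by (simp add: I_def)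
    ultimately have "2 * (int n * int n) - int n * (int n - 1) \<le> E\<^sup>2 + E"
      using half' unfolding E_def by simp
    with EE have "2 * (int n * int n) - int n * (int n - 1) < int n * (int n - 1)" by simp
    then show False by (simp add: algebra_simps)
  qed
qed

subsection \<open>The robber evades few cops\<close>

lemma finite_zball: "finite (zball r u)"
proof (rule finite_subset)
  show "zball r u \<subseteq> {fst u - r..fst u + r} \<times> {snd u - r..snd u + r}"
    by (auto simp: zball_def zdist_def)
qed simp

text \<open>The sphere of radius \<open>k + 1\<close> is covered by four half-open sides of
  \<open>k + 1\<close> points each.\<close>

lemma card_zball_le: "card (zball (int k) u) \<le> 2 * k\<^sup>2 + 2 * k + 1"
proof (induction k)
  case 0
  have "zball 0 u = {u}" by (cases u) (auto simp: zball_def)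
  then show ?case by simp
next
  case (Suc k)
  obtain a b where u: "u = (a, b)" by (cases u)
  let ?I = "{0..int k}" and ?l = "int k + 1"
  let ?P = "(\<lambda>i. (a + i, b + (?l - i))) ` ?I" and ?Q = "(\<lambda>i. (a + (?l - i), b - i)) ` ?I"
  let ?R = "(\<lambda>i. (a - i, b - (?l - i))) ` ?I" and ?S = "(\<lambda>i. (a - (?l - i), b + i)) ` ?I"
  have "zball (int (Suc k)) u \<subseteq> zball (int k) u \<union> ?P \<union> ?Q \<union> ?R \<union> ?S"
  proof
    fix x assume x: "x \<in> zball (int (Suc k)) u"
    obtain c d where xcd: "x = (c, d)" by (cases x)
    show "x \<in> zball (int k) u \<union> ?P \<union> ?Q \<union> ?R \<union> ?S"
    proof (cases "x \<in> zball (int k) u")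
      case False
      then have r: "\<bar>a - c\<bar> + \<bar>b - d\<bar> = ?l" using x by (simp add: zball_def xcd u)
      consider "c \<ge> a" "d > b" | "c > a" "d \<le> b" | "c \<le> a" "d < b" | "c < a" "d \<ge> b"
        using r by linarith
      then show ?thesis
      proof cases
        case 1
        then have "x \<in> ?P" using r xcd by (intro image_eqI[of _ _ "c - a"]) auto
        then show ?thesis by blast
      next
        case 2
        then have "x \<in> ?Q" using r xcd by (intro image_eqI[of _ _ "b - d"]) auto
        then show ?thesis by blast
      next
        case 3
        then have "x \<in> ?R" using r xcd by (intro image_eqI[of _ _ "a - c"]) auto
        then show ?thesis by blast
      next
        case 4
        then have "x \<in> ?S" using r xcd by (intro image_eqI[of _ _ "d - b"]) auto
        then show ?thesis by blast
      qed
    qed simp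
  qed
  then have "card (zball (int (Suc k)) u) \<le> card (zball (int k) u \<union> ?P \<union> ?Q \<union> ?R \<union> ?S)"
    by (intro card_mono) (auto simp: finite_zball)
  also have "\<dots> \<le> card (zball (int k) u) + card ?P + card ?Q + card ?R + card ?S"
    by (intro order_trans[OF card_Un_le] add_mono order_refl)
  also have "\<dots> \<le> (2 * k\<^sup>2 + 2 * k + 1) + Suc k + Suc k + Suc k + Suc k"
    by (intro add_mono Suc order_trans[OF card_image_le]) auto
  finally show ?case by (simp add: power2_eq_square)
qed

text \<open>If every point were missing from some stage, all of the finite set \<open>F 0\<close>
  would be gone by the largest of these stages.\<close>

lemma decreasing_finite_Inter:
  assumes "finite (F 0)" "\<And>l. F (Suc l) \<subseteq> F l" "\<And>l. F l \<noteq> {}"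
  shows "\<exists>x. \<forall>l::nat. x \<in> F l"
proof (rule ccontr)
  assume "\<not> ?thesis"
  then obtain l where l: "\<And>x. x \<notin> F (l x)" by metis
  have anti: "F j \<subseteq> F i" if "i \<le> j" for i j
    using that assms(2) by (rule lift_Suc_antimono_le[rotated])
  define L where "L = Max (l ` F 0)"
  obtain x where x: "x \<in> F L" using assms(3) by blast
  then have "x \<in> F 0" using anti[of 0 L] by blast
  then have "l x \<le> L" unfolding L_def using assms(1) by (intro Max_ge) auto
  with anti x l show False by blast
qed

text \<open>Koenig's lemma for the layered graph with layers \<open>S t\<close>.\<close>

lemma infinite_path:
  assumes fin: "\<And>t. finite (S t)" and ne: "\<And>t. S t \<noteq> {}"
    and pred: "\<And>t y. y \<in> S (Suc t) \<Longrightarrow> \<exists>x\<in>S t. R x y"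
  shows "\<exists>r. \<forall>t::nat. r t \<in> S t \<and> R (r t) (r (Suc t))"
proof -
  \<comment> \<open>\<open>P l t\<close> holds the points of layer \<open>t\<close> that start a
    path through \<open>l\<close> further layers; the infinite path stays in points belonging to
    \<open>P l t\<close> for every \<open>l\<close>.\<close>
  define P where "P = rec_nat S (\<lambda>_ Pl t. {x \<in> S t. \<exists>y\<in>Pl (Suc t). R x y})"
  have P0: "P 0 = S" and PS: "P (Suc l) t = {x \<in> S t. \<exists>y\<in>P l (Suc t). R x y}" for l t
    by (simp_all add: P_def)
  have Psub: "P l t \<subseteq> S t" for l t by (cases l) (auto simp: P0 PS)
  have dec: "P (Suc l) t \<subseteq> P l t" for l t
  proof (induction l arbitrary: t)
    case 0
    then show ?case using Psub by (simp add: P0)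
  next
    case (Suc l)
    then show ?case unfolding PS[of "Suc l"] PS[of l] by blast
  qed
  have Pne: "P l t \<noteq> {}" for l t
  proof (induction l arbitrary: t)
    case 0
    then show ?case using ne by (simp add: P0)
  next
    case (Suc l)
    then obtain y where y: "y \<in> P l (Suc t)" by blast
    with Psub pred obtain x where "x \<in> S t" "R x y" by blast
    with y show ?case by (auto simp: PS)
  qed
  have "\<exists>r. \<forall>t. (\<forall>l. r t \<in> P l t) \<and> R (r t) (r (Suc t))"
  proof (rule dependent_nat_choice)
    show "\<exists>x. \<forall>l. x \<in> P l 0"
      using fin Pne dec by (intro decreasing_finite_Inter) (auto simp: P0)
    fix x t assume x: "\<forall>l. x \<in> P l t"
    have "\<exists>y. \<forall>l. y \<in> {y \<in> P l (Suc t). R x y}"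
    proof (rule decreasing_finite_Inter)
      show "finite {y \<in> P 0 (Suc t). R x y}" using fin by (simp add: P0)
      show "{y \<in> P (Suc l) (Suc t). R x y} \<subseteq> {y \<in> P l (Suc t). R x y}" for l
        using dec by blast
      show "{y \<in> P l (Suc t). R x y} \<noteq> {}" for l
        using x[rule_format, of "Suc l"] by (auto simp: PS)
    qed
    then show "\<exists>y. (\<forall>l. y \<in> P l (Suc t)) \<and> R x y" by blast
  qed
  then show ?thesis using P0 by metis
qed

lemma not_cops_win:
  assumes few: "m * (2 * k\<^sup>2 + 2 * k + 1) < n" and n: "3 \<le> n"
  shows "\<not> cops_win (grid_graph n) k m"
proof
  let ?G = "grid_graph n"
  assume "cops_win ?G k m"
  then obtain \<sigma> where \<sigma>: "cop_strategy ?G m \<sigma>"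
    and win: "\<And>r. robber_walk ?G r \<Longrightarrow> \<exists>t. \<exists>!v. v \<in> candidates ?G k \<sigma> r t"
    unfolding cops_win_def by blast
  \<comment> \<open>An unseen robber yields only \<open>None\<close>, so the cops' positions
    \<open>\<sigma> (blank t)\<close> against him are known in advance.\<close>
  define blank where "blank t = replicate t (replicate m (None :: nat option))" for t
  define seen where "seen t = (\<Union>u\<in>set (\<sigma> (blank t)). {x \<in> verts ?G. gdist ?G u x \<le> k})" for t
  have card_seen: "card (seen t) \<le> n - 1" for t
  proof -
    have U: "length (\<sigma> (blank t)) = m" "set (\<sigma> (blank t)) \<subseteq> verts ?G"
      using \<sigma> by (auto simp: cop_strategy_def)
    have "card {x \<in> verts ?G. gdist ?G u x \<le> k} \<le> 2 * k\<^sup>2 + 2 * k + 1" if "u \<in> set (\<sigma> (blank t))" for u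
    proof -
      have "zpt ` {x \<in> verts ?G. gdist ?G u x \<le> k} \<subseteq> zball (int k) (zpt u)"
        using gdist_grid_graph[of u n] that U(2) by (fastforce simp: zball_def)
      then have "card (zpt ` {x \<in> verts ?G. gdist ?G u x \<le> k}) \<le> card (zball (int k) (zpt u))"
        by (intro card_mono finite_zball)
      with card_zball_le[of k "zpt u"] show ?thesis
        by (simp add: card_image inj_on_def)
    qed
    then have "card (seen t) \<le> (\<Sum>u\<in>set (\<sigma> (blank t)). 2 * k\<^sup>2 + 2 * k + 1)"
      unfolding seen_def by (intro order_trans[OF card_UN_le] sum_mono) auto
    also have "\<dots> = card (set (\<sigma> (blank t))) * (2 * k\<^sup>2 + 2 * k + 1)" by simp
    also have "\<dots> \<le> m * (2 * k\<^sup>2 + 2 * k + 1)"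
      using card_length[of "\<sigma> (blank t)"] U(1) by (intro mult_le_mono1) simp
    finally show ?thesis using few by simp
  qed
  define S where "S = rec_nat (verts ?G - seen 0) (\<lambda>t St. gnbhd n St - seen (Suc t))"
  have S0: "S 0 = verts ?G - seen 0" and SS: "S (Suc t) = gnbhd n (S t) - seen (Suc t)" for t
    by (simp_all add: S_def)
  have Ssub: "S t \<subseteq> verts ?G" for t
    by (cases t) (auto simp: S0 SS gnbhd_def)
  have Sseen: "S t \<inter> seen t = {}" for t
    by (cases t) (auto simp: S0 SS)
  have Sfin: "finite (S t)" for t using Ssub finite_subset finite_verts_grid_graph by blast
  define T where "T = n * (n - 1) div 2"
  have "even (n * (n - 1))" by (cases n) auto
  then have T: "2 * T = n * (n - 1)" unfolding T_def by simp
  have big: "T \<le> card (S t)" for t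
  proof (induction t)
    case 0
    have "n * n - (n - 1) \<le> card (S 0)"
      using diff_card_le_card_Diff[of "seen 0" "verts ?G"] card_seen[of 0]
      by (simp add: S0 card_verts_grid_graph seen_def)
    moreover have "2 * T + 2 * (n - 1) \<le> 2 * (n * n)"
    proof -
      have "n * (n - 1) + 2 * (n - 1) = (n + 2) * (n - 1)" by (simp only: distrib_right)
      also have "\<dots> \<le> (2 * n) * n" using n by (intro mult_mono) auto
      finally show ?thesis using T by simp
    qed
    ultimately show ?case by simp
  next
    case (Suc t)
    \<comment> \<open>The expansion bound is for exactly \<open>T\<close> vertices, so it is applied
      to a subset of that size.\<close>
    then obtain D where D: "D \<subseteq> S t" "card D = T" using obtain_subset_with_card_n by metis
    have "T + (n - 1) \<le> card (gnbhd n D)"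
      using card_gnbhd_ge[of D n] D Ssub T by auto
    also have "\<dots> \<le> card (gnbhd n (S t))"
      using D(1) by (intro card_mono) (auto simp: gnbhd_def)
    finally have "T + (n - 1) \<le> card (gnbhd n (S t))" .
    moreover have "card (gnbhd n (S t)) - card (seen (Suc t)) \<le> card (S (Suc t))"
      unfolding SS by (intro diff_card_le_card_Diff) (simp add: seen_def)
    ultimately show ?case using card_seen[of "Suc t"] by simp
  qed
  have "2 \<le> T"
  proof -
    have "3 * 2 \<le> n * (n - 1)" using n by (intro mult_mono) auto
    with T show ?thesis by simp
  qed
  define step where "step x y \<longleftrightarrow> y = x \<or> adj ?G x y" for x y
  have pred: "\<exists>x\<in>S t. step x y" if "y \<in> S (Suc t)" for t y
    using that by (auto simp: SS gnbhd_def step_def)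
  have blank_history: "history ?G k \<sigma> r t = blank t" if "\<And>i. i < t \<Longrightarrow> r i \<in> S i" for r t
    using that
  proof (induction t)
    case (Suc t)
    have "probe ?G k u (r t) = None" if "u \<in> set (\<sigma> (blank t))" for u
      using that Suc.prems[of t] Sseen[of t] Ssub[of t] by (auto simp: seen_def probe_def)
    moreover have "length (\<sigma> (blank t)) = m" using \<sigma> by (simp add: cop_strategy_def)
    ultimately have "map (\<lambda>u. probe ?G k u (r t)) (\<sigma> (blank t)) = replicate m None"
      by (intro nth_equalityI) auto
    with Suc show ?case by (simp add: blank_def replicate_append_same)
  qed (simp add: blank_def)
  have "S t \<noteq> {}" for t using big[of t] \<open>2 \<le> T\<close> by auto
  then obtain r where r: "\<And>t. r t \<in> S t" "\<And>t. step (r t) (r (Suc t))"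
    using infinite_path[of S step] Sfin pred by blast
  have walk: "robber_walk ?G r" using r Ssub unfolding robber_walk_def step_def by blast
  have reached: "\<exists>r'. robber_walk ?G r' \<and> (\<forall>i\<le>t. r' i \<in> S i) \<and> r' t = x" if "x \<in> S t" for t x
    using that
  proof (induction t arbitrary: x)
    case 0
    then show ?case using Ssub by (intro exI[of _ "\<lambda>_. x"]) (auto simp: robber_walk_def)
  next
    case (Suc t)
    obtain w where w: "w \<in> S t" "step w x" using pred[OF Suc.prems] by blast
    obtain r' where r': "robber_walk ?G r'" "\<forall>i\<le>t. r' i \<in> S i" "r' t = w" using Suc.IH[OF w(1)] by blast
    \<comment> \<open>The walk has to be infinite; it stands still once \<open>x\<close> is reached,
      as only the answers up to then matter.\<close>
    let ?r = "\<lambda>i. if i \<le> t then r' i else x"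
    have "robber_walk ?G ?r"
      unfolding robber_walk_def
    proof (intro conjI allI)
      fix i
      show "?r i \<in> verts ?G" using r'(1) Suc.prems Ssub by (auto simp: robber_walk_def)
      show "?r (Suc i) = ?r i \<or> adj ?G (?r i) (?r (Suc i))"
        using r'(1,3) w(2) unfolding robber_walk_def step_def
        by (cases "i < t"; cases "i = t") auto
    qed
    moreover have "\<forall>i\<le>Suc t. ?r i \<in> S i" using r'(2) Suc.prems by (auto simp: le_Suc_eq)
    ultimately show ?case by (intro exI[of _ ?r]) auto
  qed
  obtain t where t: "\<exists>!v. v \<in> candidates ?G k \<sigma> r t" using win[OF walk] by blast
  have "S t \<subseteq> candidates ?G k \<sigma> r t"
  proof
    fix x assume "x \<in> S t"
    from reached[OF this] obtain r' where r': "robber_walk ?G r'" "\<forall>i\<le>t. r' i \<in> S i" "r' t = x" by blast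
    have "history ?G k \<sigma> r' (Suc t) = history ?G k \<sigma> r (Suc t)"
      using blank_history[of "Suc t" r'] blank_history[of "Suc t" r] r'(2) r(1) by (simp del: history.simps)
    with r' show "x \<in> candidates ?G k \<sigma> r t" unfolding candidates_def by blast
  qed
  with t have "S t \<subseteq> {THE v. v \<in> candidates ?G k \<sigma> r t}"
    by (auto intro: the1_equality[symmetric])
  then have "card (S t) \<le> 1" using card_mono[of "{THE v. v \<in> candidates ?G k \<sigma> r t}" "S t"] by simp
  with big[of t] \<open>2 \<le> T\<close> show False by simp
qed

subsection \<open>Localizing a robber that has been seen\<close>

text \<open>Candidate sets are kept as lists so that the decision trees below can be checked by
  evaluation.\<close>

definition nbrs :: "int \<times> int \<Rightarrow> (int \<times> int) list" where
  "nbrs p = [p, (fst p + 1, snd p), (fst p - 1, snd p), (fst p, snd p + 1), (fst p, snd p - 1)]"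

lemma set_nbrs: "y \<in> set (nbrs x) \<longleftrightarrow> zdist x y \<le> 1"
proof -
  obtain a b c d where xy: "x = (a, b)" "y = (c, d)" by (cases x; cases y)
  define e f where "e = c - a" and "f = d - b"
  then have cd: "c = a + e" "d = b + f" by simp_all
  have "\<bar>e\<bar> + \<bar>f\<bar> \<le> 1 \<longleftrightarrow> e = 0 \<and> f = 0 \<or> e = 1 \<and> f = 0 \<or> e = -1 \<and> f = 0 \<or> e = 0 \<and> f = 1 \<or> e = 0 \<and> f = -1"
    by arith
  then show ?thesis unfolding xy cd by (auto simp: nbrs_def)
qed

definition spread :: "(int \<times> int) list \<Rightarrow> (int \<times> int) list" where
  "spread L = remdups (concat (map nbrs L))"

lemma reach_set: "reach B (set L) = B \<inter> set (spread L)"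
  by (auto simp: reach_def spread_def set_nbrs simp del: zdist_Pair)

text \<open>In \<open>Probe U Ps\<close> the candidates with the same answers as \<open>z\<close>, if there are several of them,
  are treated by the plan paired with \<open>z\<close> in \<open>Ps\<close>. A \<open>Leaf c\<close> refers to a known position, with
  the hint \<open>c\<close> saying where it is located.\<close>

datatype plan = Leaf "int \<times> int" | Probe "(int \<times> int) list" "((int \<times> int) \<times> plan) list"

definition answers :: "nat \<Rightarrow> (int \<times> int) list \<Rightarrow> int \<times> int \<Rightarrow> int option list" where
  "answers k U x = map (\<lambda>u. zprobe k u x) U"

fun solves ::
  "(int \<times> int \<Rightarrow> (int \<times> int) list \<Rightarrow> bool) \<Rightarrow> nat \<Rightarrow> nat \<Rightarrow> plan \<Rightarrow> (int \<times> int) list \<Rightarrow> bool"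
where
  "solves known k m (Leaf c) L = known c L"
| "solves known k m (Probe U Ps) L \<longleftrightarrow> length U \<le> m \<and>
    list_all (\<lambda>(z, P). solves known k m P (spread (filter (\<lambda>y. answers k U y = answers k U z) L))) Ps \<and>
    list_all (\<lambda>x. filter (\<lambda>y. answers k U y = answers k U x) L = [x] \<or>
      list_ex (\<lambda>z. answers k U z = answers k U x) (map fst Ps)) L"

text \<open>A plan is checked without reference to \<open>B\<close>: intersecting with
  \<open>B\<close> only removes candidates, so one evaluation serves every region.\<close>

lemma solves_imp_localizable:
  assumes "solves known k m P L"
    and known: "\<And>c L. known c L \<Longrightarrow> localizable B k m (B \<inter> set L)"
  shows "localizable B k m (B \<inter> set L)"
  using assms(1)
proof (induction P arbitrary: L)
  case (Leaf c)
  then show ?case by (simp add: known)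
next
  case (Probe U Ps)
  have indist: "indist k U (B \<inter> set L) x \<subseteq> set (filter (\<lambda>y. answers k U y = answers k U x) L)" for x
    by (auto simp: indist_def answers_def)
  show ?case
  proof (rule localizable.step)
    show "length U \<le> m" using Probe.prems by simp
    fix x assume x: "x \<in> B \<inter> set L"
    then consider "filter (\<lambda>y. answers k U y = answers k U x) L = [x]"
      | z P where "(z, P) \<in> set Ps" "answers k U z = answers k U x"
      using Probe.prems by (auto simp: list_all_iff list_ex_iff)
    then show "indist k U (B \<inter> set L) x \<subseteq> {x} \<or>
        localizable B k m (reach B (indist k U (B \<inter> set L) x))"
    proof cases
      case 1
      then show ?thesis using indist[of x] by simp
    next
      case 2
      let ?L = "filter (\<lambda>y. answers k U y = answers k U z) L"
      have "solves known k m P (spread ?L)"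
        using Probe.prems 2(1) by (auto simp: list_all_iff)
      with Probe.IH[OF 2(1), of P] have "localizable B k m (B \<inter> set (spread ?L))"
        by (simp del: solves.simps)
      then have "localizable B k m (reach B (set ?L))" by (simp only: reach_set)
      moreover have "reach B (indist k U (B \<inter> set L) x) \<subseteq> reach B (set ?L)"
        using indist[of x] 2(2) by (intro reach_mono) auto
      ultimately show ?thesis using localizable_mono by blast
    qed
  qed
qed

definition disc :: "int \<Rightarrow> (int \<times> int) list" where
  "disc r = concat (map (\<lambda>x. map (Pair x) [\<bar>x\<bar> - r..r - \<bar>x\<bar>]) [- r..r])"

lemma set_disc: "set (disc r) = zball r (0, 0)"
  by (auto simp: disc_def zball_def image_iff)

lemma shift_zball: "shift v ` zball r u = zball r (shift v u)"
proof -
  have "x \<in> shift v ` zball r u" if "x \<in> zball r (shift v u)" for x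
  proof -
    have "x = shift v (fst x - fst v, snd x - snd v)" by (simp add: shift_def)
    with that show ?thesis unfolding zball_def by (metis (mono_tags, lifting) image_eqI mem_Collect_eq zdist_shift)
  qed
  then show ?thesis by (auto simp: zball_def)
qed

text \<open>In the whole plane two cops with visibility two cannot win, so the left boundary of the grid
  has to be used.\<close>

definition half_plane :: "int \<Rightarrow> (int \<times> int) set" where
  "half_plane w = {p. w \<le> fst p}"

lemma half_plane_mono: "w \<le> w' \<Longrightarrow> half_plane w' \<subseteq> half_plane w"
  by (auto simp: half_plane_def)

lemma shift_half_plane: "shift v ` half_plane w = half_plane (fst v + w)"
proof -
  have "x \<in> shift v ` half_plane w" if "fst v + w \<le> fst x" for x
    using that by (intro image_eqI[of _ _ "(fst x - fst v, snd x - snd v)"])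
      (auto simp: shift_def half_plane_def)
  then show ?thesis by (auto simp: half_plane_def shift_def)
qed

definition diag :: "int \<Rightarrow> int \<times> int \<Rightarrow> (int \<times> int) list" where
  "diag s c = [c, (fst c + 1, snd c + s)]"

lemma shift_reach_diag:
  "shift v ` reach (half_plane w) (set (diag s c)) =
    reach (half_plane (fst v + w)) (set (diag s (shift v c)))"
  unfolding reach_shift[symmetric] shift_half_plane by (simp add: diag_def shift_def add.assoc)

text \<open>The cops' answers always leave at most one pair, the given one moved to the left by one column;
  at the boundary they leave none.\<close>

lemma localizable_diag:
  assumes s: "s = 1 \<or> s = -1"
  shows "localizable (half_plane w) 2 2 (reach (half_plane w) (set (diag s c)))"
proof -
  have base: "localizable (half_plane 0) 2 2 (reach (half_plane 0) (set (diag s (0, 0))))"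
  proof -
    \<comment> \<open>With the points beyond the boundary removed, one round separates all
      candidates.\<close>
    have "solves (\<lambda>_ _. False) 2 2 (Probe [(0, -s), (0, 2 * s)] [])
        (filter (\<lambda>p. 0 \<le> fst p) (spread (diag s (0, 0))))"
      using s by (elim disjE; hypsubst) code_simp+
    then have "localizable (half_plane 0) 2 2
        (half_plane 0 \<inter> set (filter (\<lambda>p. 0 \<le> fst p) (spread (diag s (0, 0)))))"
      by (rule solves_imp_localizable) simp
    moreover have "reach (half_plane 0) (set (diag s (0, 0))) =
        half_plane 0 \<inter> set (filter (\<lambda>p. 0 \<le> fst p) (spread (diag s (0, 0))))"
      unfolding reach_set by (auto simp: half_plane_def)
    ultimately show ?thesis by simp
  qed
  \<comment> \<open>Induction on the number \<open>d\<close> of columns between the pair and the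
    boundary.\<close>
  have left: "localizable (half_plane (- int d)) 2 2 (reach (half_plane (- int d)) (set (diag s (0, 0))))" for d
  proof (induction d)
    case 0
    then show ?case using base by simp
  next
    case (Suc d)
    let ?B = "half_plane (- int (Suc d))"
    let ?known = "\<lambda>(c :: int \<times> int) L. L = spread (diag s (-1, 0))"
    have "shift (-1, 0) ` reach (half_plane (- int d)) (set (diag s (0, 0))) =
        reach ?B (set (diag s (-1, 0)))"
      unfolding shift_reach_diag by (simp add: shift_def)
    with localizable_shift[OF Suc.IH, of "(-1, 0)"]
    have "localizable ?B 2 2 (reach ?B (set (diag s (-1, 0))))"
      by (simp add: shift_half_plane)
    then have known: "localizable ?B 2 2 (?B \<inter> set L)" if "?known c L" for c :: "int \<times> int" and L
      using that by (simp add: reach_set)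
    \<comment> \<open>The only ambiguous answers are those of \<open>(-1, 0)\<close> and
      \<open>(0, s)\<close>, again a diagonal pair of slope \<open>s\<close>, one column further
      left.\<close>
    have "solves ?known 2 2 (Probe [(0, -s), (2, 0)] [((-1, 0), Leaf (-1, 0))]) (spread (diag s (0, 0)))"
      using s by (elim disjE; hypsubst) code_simp+
    from solves_imp_localizable[OF this known] show ?case by (simp add: reach_set)
  qed
  \<comment> \<open>If \<open>c\<close> lies left of column \<open>w\<close>, then
    \<open>d = 0\<close>, and the half plane starting at \<open>c\<close> contains the required
    one.\<close>
  define d where "d = nat (fst c - w)"
  have "shift c ` reach (half_plane (- int d)) (set (diag s (0, 0))) =
      reach (half_plane (fst c - int d)) (set (diag s c))"
    unfolding shift_reach_diag by (simp add: shift_def)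
  with localizable_shift[OF left[of d], of c]
  have "localizable (half_plane (fst c - int d)) 2 2 (reach (half_plane (fst c - int d)) (set (diag s c)))"
    by (simp add: shift_half_plane)
  moreover have "half_plane w \<subseteq> half_plane (fst c - int d)"
    by (rule half_plane_mono) (simp add: d_def)
  ultimately show ?thesis
    using localizable_mono[OF _ _ order_refl order_refl reach_mono[OF _ order_refl]] by blast
qed

section \<open>Decision trees for visibility one, two and three\<close>

lemma localizable_half_plane_shift:
  assumes "\<And>w. localizable (half_plane w) k m (half_plane w \<inter> zball r (0, 0))"
  shows "localizable (half_plane w) k m (half_plane w \<inter> zball r u)"
proof -
  have "shift u ` (half_plane (w - fst u) \<inter> zball r (0, 0)) = half_plane w \<inter> zball r u"
    by (subst image_Int) (auto simp: inj_on_def shift_half_plane shift_zball, auto simp: shift_def)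
  with localizable_shift[OF assms, of u "w - fst u"] show ?thesis
    by (simp add: shift_half_plane)
qed

text \<open>The tree has no leaves: at most four rounds of probes single out the robber.\<close>

lemma localizable_zball_1_3: "localizable (half_plane w) 1 3 (half_plane w \<inter> zball 2 u)"
proof (rule localizable_half_plane_shift)
  fix w
  let ?P = "Probe [(-1, 0), (0, 1), (1, 0)] [((-2, 0), Probe [(1, -1), (-1, -1), (-3, -1)] [((-2, 0),
      Probe [(-3, 0), (-2, 1), (-1, 0)] []), ((-1, -2), Probe [(-2, -1), (-1, 0), (0, -1)]
      [((-1, -3), Probe [(-2, -3), (-1, -2), (0, -3)] [])])]), ((0, -2), Probe [(-1, -2), (0,
      -1), (1, -2)] []), ((1, -1), Probe [(-1, -1), (1, -1), (3, -1)] [((1, -2), Probe [(0,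
      -1), (1, 0), (2, -1)] [((1, -3), Probe [(0, -3), (1, -2), (2, -3)] [])]), ((2, 0), Probe
      [(1, 0), (2, 1), (3, 0)] [])])]"
  have "solves (\<lambda>_ _. False) 1 3 ?P (disc 2)" by code_simp
  then have "localizable (half_plane w) 1 3 (half_plane w \<inter> set (disc 2))"
    by (rule solves_imp_localizable) simp
  then show "localizable (half_plane w) 1 3 (half_plane w \<inter> zball 2 (0, 0))"
    by (simp only: set_disc)
qed

text \<open>At each leaf the candidates lie in the neighbourhood of one diagonal pair, placed at the
  hint, and \<open>localizable_diag\<close> takes over.\<close>

lemma localizable_zball_2_2: "localizable (half_plane w) 2 2 (half_plane w \<inter> zball 3 u)"
proof (rule localizable_half_plane_shift)
  fix w
  let ?known = "\<lambda>(c :: int \<times> int) L. list_all (\<lambda>x. x \<in> set (spread (diag 1 c))) L \<or>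
    list_all (\<lambda>x. x \<in> set (spread (diag (-1) c))) L"
  let ?P = "Probe [(0, -1), (0, 1)] [((-3, 0), Probe [(-2, 0), (1, 0)] [((-4, 0), Probe [(-2, 1), (-3,
      -1)] [((-4, -1), Leaf (-4, -1)), ((-4, 1), Leaf (-4, 1)), ((-3, 0), Leaf (-3, 0))]),
      ((-3, 0), Probe [(-1, 1), (-2, -1)] [((-3, -1), Leaf (-3, -1)), ((-3, 1), Leaf (-3, 1)),
      ((-2, 0), Leaf (-2, 0))]), ((2, -1), Probe [(1, 1), (2, -1)] [((1, -1), Leaf (1, -1)),
      ((2, -2), Leaf (2, -2)), ((2, 2), Leaf (2, 2))]), ((3, -1), Probe [(2, 1), (3, -1)]
      [((2, -1), Leaf (2, -1)), ((3, -2), Leaf (3, -2)), ((3, 2), Leaf (3, 2))])]), ((-2, -1),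
      Probe [(1, -1), (-1, -3)] [((-3, -1), Probe [(-1, 0), (-2, -2)] [((-3, 0), Leaf (-3,
      0)), ((-2, 0), Leaf (-2, 0))]), ((-2, -2), Probe [(-1, -3), (-3, -2)] [((-2, -3), Leaf
      (-2, -3)), ((-1, -4), Leaf (-1, -4)), ((0, -5), Leaf (0, -5))]), ((-1, -2), Leaf (-1,
      -2)), ((-1, -1), Probe [(1, -2), (0, -1)] [((-2, -1), Leaf (-2, -1)), ((-1, -2), Leaf
      (-1, -2)), ((1, -4), Leaf (1, -4))]), ((1, -2), Leaf (1, -2)), ((2, -2), Probe [(1, 0),
      (2, -2)] [((1, -2), Leaf (1, -2)), ((2, -3), Leaf (2, -3)), ((2, 1), Leaf (2, 1))])]),
      ((-2, 1), Probe [(1, 1), (-1, 3)] [((-3, 1), Probe [(-1, 0), (-2, 2)] [((-3, 0), Leaf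
      (-3, 0)), ((-2, 0), Leaf (-2, 0))]), ((-2, 2), Probe [(-1, 3), (1, 4)] [((-3, 2), Leaf
      (-3, 2)), ((-2, 3), Leaf (-2, 3)), ((-1, 4), Leaf (-1, 4))]), ((-1, 1), Probe [(-1, 2),
      (0, 3)] [((-2, 1), Leaf (-2, 1)), ((0, 1), Leaf (0, 1)), ((1, 4), Leaf (1, 4))]), ((-1,
      2), Leaf (-1, 2)), ((1, 2), Leaf (1, 2)), ((2, 0), Probe [(1, 2), (2, 0)] [((1, 0), Leaf
      (1, 0)), ((2, -1), Leaf (2, -1)), ((2, 3), Leaf (2, 3))])]), ((-1, -1), Probe [(1, 0),
      (-1, -1)] [((-2, -1), Leaf (-2, -1)), ((-1, 0), Leaf (-1, 0)), ((1, -2), Leaf (1,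
      -2))]), ((-1, 0), Probe [(0, -1), (2, 0)] [((-2, 0), Leaf (-2, 0)), ((0, 0), Leaf (0,
      0))]), ((-1, 1), Probe [(1, 0), (-1, 1)] [((-2, 1), Leaf (-2, 1)), ((-1, 0), Leaf (-1,
      0)), ((1, 2), Leaf (1, 2))])]"
  have known: "localizable (half_plane w) 2 2 (half_plane w \<inter> set L)" if "?known c L" for c :: "int \<times> int" and L
  proof -
    have "set L \<subseteq> set (spread (diag 1 c)) \<or> set L \<subseteq> set (spread (diag (-1) c))"
      using that unfolding list_all_iff by blast
    then obtain s :: int where s: "s = 1 \<or> s = -1" "set L \<subseteq> set (spread (diag s c))"
      by blast
    then have "half_plane w \<inter> set L \<subseteq> reach (half_plane w) (set (diag s c))"
      by (auto simp: reach_set)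
    with localizable_diag[OF s(1)] show ?thesis
      using localizable_mono[OF _ order_refl order_refl order_refl] by blast
  qed
  have "solves ?known 2 2 ?P (disc 3)" by code_simp
  from solves_imp_localizable[OF this known]
  show "localizable (half_plane w) 2 2 (half_plane w \<inter> zball 3 (0, 0))"
    by (simp add: set_disc)
qed

text \<open>At most two rounds confine the robber to a ball of radius three, where visibility two
  suffices. This provides the radius 4 from which \<open>localizable_zball_step\<close>
  starts.\<close>

lemma localizable_zball_3_2: "localizable (half_plane w) 3 2 (half_plane w \<inter> zball 4 u)"
proof (rule localizable_half_plane_shift)
  fix w
  let ?known = "\<lambda>c L. list_all (\<lambda>x. zdist c x \<le> 3) L"
  let ?P = "Probe [(-1, -1), (0, 1)] [((-4, 0), Probe [(2, 0), (1, -3)] [((-5, 0), Leaf (-5, 0)), ((-1,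
      -4), Leaf (-2, -5)), ((0, -3), Leaf (-1, -4)), ((1, -2), Leaf (0, -3)), ((3, -1), Leaf
      (2, 0)), ((4, -1), Leaf (3, 0))]), ((-3, -1), Leaf (-3, -3)), ((-3, 0), Probe [(1, -2),
      (-2, -3)] [((-4, 0), Leaf (-4, 0)), ((-3, -1), Leaf (-4, 0)), ((0, -2), Leaf (-1, -3)),
      ((1, -1), Leaf (0, -2)), ((2, 0), Leaf (1, -1))]), ((-3, 1), Probe [(2, 2), (0, 3)]
      [((-4, 1), Leaf (-4, 1)), ((-2, 3), Leaf (-2, 5)), ((-1, 2), Leaf (-1, 4)), ((-1, 3),
      Leaf (-2, 4)), ((1, 0), Leaf (2, 1)), ((1, 2), Leaf (0, 3)), ((2, 0), Leaf (1, 1)), ((2,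
      1), Leaf (1, 2))]), ((-2, -1), Leaf (-3, -2)), ((-2, 0), Leaf (-1, -1)), ((-2, 1), Leaf
      (-1, 0)), ((-1, 0), Leaf (-2, -1)), ((-1, 1), Leaf (-2, 0)), ((0, 2), Leaf (-1, 1)),
      ((0, 3), Leaf (0, 1))]"
  have known: "localizable (half_plane w) 3 2 (half_plane w \<inter> set L)" if "?known c L" for c :: "int \<times> int" and L
  proof -
    have "half_plane w \<inter> set L \<subseteq> half_plane w \<inter> zball 3 c"
      using that by (auto simp: list_all_iff zball_def)
    then show ?thesis
      using localizable_mono[OF localizable_zball_2_2 order_refl, of 3 2] by simp
  qed
  have "solves ?known 3 2 ?P (disc 4)" by code_simp
  from solves_imp_localizable[OF this known]
  show "localizable (half_plane w) 3 2 (half_plane w \<inter> zball 4 (0, 0))"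
    by (simp add: set_disc)
qed

section \<open>Induction on the visibility\<close>

lemma abs_add_abs_le_iff: "\<bar>a\<bar> + \<bar>b\<bar> \<le> r \<longleftrightarrow> \<bar>a + b\<bar> \<le> r \<and> \<bar>a - b\<bar> \<le> (r :: int)"
  by arith

lemma reach_zball: "reach B (zball r u) \<subseteq> B \<inter> zball (r + 1) u"
proof
  fix y assume "y \<in> reach B (zball r u)"
  then obtain x where "x \<in> zball r u" "zdist x y \<le> 1" "y \<in> B" by (auto simp: reach_def)
  with zdist_triangle[of u y x] show "y \<in> B \<inter> zball (r + 1) u" by (simp add: zball_def)
qed

text \<open>Balls are squares in the coordinates \<open>x + y\<close> and \<open>x - y\<close>. Two cops side by side that count
  the robber as seen within distance \<open>r - 1\<close> clear all of the square except six diagonals in the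
  first round, and these in the second.\<close>

lemma localizable_zball_step:
  fixes r :: int
  assumes r: "4 \<le> r" "r - 1 \<le> int k"
    and smaller: "\<And>u. localizable B k 2 (B \<inter> zball r u)"
  shows "localizable B k 2 (B \<inter> zball (r + 1) u)"
proof -
  obtain a b where u: "u = (a, b)" by (cases u)
  let ?s = "r - 1"
  \<comment> \<open>Relative to \<open>u\<close>, the squares of \<open>?U\<close> cover the part of
    the ball with \<open>x - y\<close> at most \<open>r - 3\<close>. The rest \<open>D\<close> spans
    four diagonals, six after a move; the squares of \<open>?V\<close> cover these because
    \<open>r\<close> is at least 4.\<close>
  let ?U = "[(a - 2, b), (a - 2 + ?s, b + ?s)]" and ?V = "[(a, b - 3), (a + ?s, b + ?s - 3)]"
  define D where "D = {x. \<bar>fst x - a + (snd x - b)\<bar> \<le> r + 1 \<and>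
    r - 2 \<le> fst x - a - (snd x - b) \<and> fst x - a - (snd x - b) \<le> r + 1}"
  define D' where "D' = {x. \<bar>fst x - a + (snd x - b)\<bar> \<le> r + 2 \<and>
    r - 3 \<le> fst x - a - (snd x - b) \<and> fst x - a - (snd x - b) \<le> r + 2}"
  have seen: "localizable B k 2 (reach B (zball ?s v))" for v
    using localizable_mono[OF smaller order_refl order_refl order_refl] reach_zball[of B ?s v] by simp
  have sub: "{x \<in> B \<inter> zball (r + 1) u. \<forall>u\<in>set ?U. ?s < zdist u x} \<subseteq> D"
  proof
    fix x assume x: "x \<in> {x \<in> B \<inter> zball (r + 1) u. \<forall>u\<in>set ?U. ?s < zdist u x}"
    obtain c d where xcd: "x = (c, d)" by (cases x)
    have "\<bar>a - c\<bar> + \<bar>b - d\<bar> \<le> r + 1" "\<not> \<bar>a - 2 - c\<bar> + \<bar>b - d\<bar> \<le> ?s"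
      "\<not> \<bar>a - 2 + ?s - c\<bar> + \<bar>b + ?s - d\<bar> \<le> ?s"
      using x by (auto simp: xcd u zball_def)
    then show "x \<in> D" using r unfolding abs_add_abs_le_iff D_def xcd by simp arith
  qed
  have reach_D: "reach B D \<subseteq> D'"
  proof
    fix y assume "y \<in> reach B D"
    then obtain x where "x \<in> D" "zdist x y \<le> 1" by (auto simp: reach_def)
    then show "y \<in> D'" unfolding zdist_def abs_add_abs_le_iff D_def D'_def by simp arith
  qed
  have none: "{x \<in> D'. \<forall>u\<in>set ?V. ?s < zdist u x} = {}"
  proof -
    have False if x: "x \<in> D'" "\<forall>u\<in>set ?V. ?s < zdist u x" for x
    proof -
      obtain c d where xcd: "x = (c, d)" by (cases x)
      have "\<not> \<bar>a - c\<bar> + \<bar>b - 3 - d\<bar> \<le> ?s" "\<not> \<bar>a + ?s - c\<bar> + \<bar>b + ?s - 3 - d\<bar> \<le> ?s"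
        using x by (auto simp: xcd)
      with x(1) r show False unfolding abs_add_abs_le_iff D'_def xcd by simp arith
    qed
    then show ?thesis by blast
  qed
  have "localizable B k 2 D'"
  proof (rule localizable_blind[where U = ?V and r = ?s])
    show "localizable B k 2 (reach B {x \<in> D'. \<forall>u\<in>set ?V. ?s < zdist u x})"
      unfolding none by (simp add: reach_def localizable_empty)
  qed (use r seen in auto)
  then have "localizable B k 2 (reach B D)" using reach_D localizable_mono by blast
  then have "localizable B k 2 (reach B {x \<in> B \<inter> zball (r + 1) u. \<forall>u\<in>set ?U. ?s < zdist u x})"
    using reach_mono[OF order_refl sub] localizable_mono by blast
  then show ?thesis
    by (rule localizable_blind[where U = ?U, OF _ r(2) seen, rotated]) simp
qed

lemma localizable_zball_half_plane:
  assumes "2 \<le> k"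
  shows "localizable (half_plane w) k 2 (half_plane w \<inter> zball (int k + 1) u)"
  using assms
proof (induction k arbitrary: u rule: dec_induct)
  case base
  then show ?case using localizable_zball_2_2 by simp
next
  case (step k)
  show ?case
  proof (cases "k = 2")
    case True
    then show ?thesis using localizable_zball_3_2 by simp
  next
    case False
    have "localizable (half_plane w) (Suc k) 2 (half_plane w \<inter> zball (int k + 1) u)" for u
      by (rule localizable_mono[OF step.IH[of u] order_refl _ order_refl order_refl]) simp
    from localizable_zball_step[OF _ _ this] False step.hyps
    show ?thesis by (simp add: add.commute)
  qed
qed

lemma localizable_zbox_seen:
  assumes "k = 1 \<and> 3 \<le> m \<or> 2 \<le> k \<and> 2 \<le> m"
  shows "localizable (zbox n) k m (reach (zbox n) (zball (int k) u))"
proof -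
  have box: "zbox n \<subseteq> half_plane 1" by (auto simp: zbox_def half_plane_def)
  have "localizable (half_plane 1) k m (half_plane 1 \<inter> zball (int k + 1) u)"
    using assms
  proof
    assume k: "k = 1 \<and> 3 \<le> m"
    then show ?thesis
      using localizable_mono[OF localizable_zball_1_3 order_refl order_refl _ order_refl, of m 1 u] by simp
  next
    assume k: "2 \<le> k \<and> 2 \<le> m"
    then show ?thesis
      using localizable_mono[OF localizable_zball_half_plane order_refl order_refl _ order_refl, of k m 1 u] by simp
  qed
  moreover have "reach (zbox n) (zball (int k) u) \<subseteq> half_plane 1 \<inter> zball (int k + 1) u"
    using reach_zball[of "zbox n" "int k" u] box by auto
  ultimately show ?thesis using localizable_mono[OF _ box order_refl order_refl] by blast
qed

subsection \<open>Sweeping the grid\<close>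

text \<open>This makes the balls of radius \<open>K\<close> around the lattice points
  \<open>((2 * K + 1) * c + N * z, c)\<close> disjoint. A difference shorter than
  \<open>2 * K + 1\<close> makes \<open>2 * N * z\<close> too small for a nonzero \<open>z\<close>,
  and then \<open>x + y\<close> too small to be nonzero.\<close>

lemma lattice_separated:
  fixes K :: int
  assumes K: "0 \<le> K" and x: "x = (2 * K + 1) * y + (2 * K\<^sup>2 + 2 * K + 1) * w"
    and small: "\<bar>x\<bar> + \<bar>y\<bar> \<le> 2 * K"
  shows "x = 0 \<and> y = 0"
proof -
  define N where "N = 2 * K\<^sup>2 + 2 * K + 1"
  define z where "z = y + K * w"
  have eq: "2 * (N * z) = (2 * K + 1) * (x + y) - (x - y)"
    unfolding x z_def N_def by (simp add: power2_eq_square algebra_simps)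
  have sum: "\<bar>x + y\<bar> \<le> 2 * K" "\<bar>x - y\<bar> \<le> 2 * K" using small by linarith+
  have "(2 * K + 1) * \<bar>x + y\<bar> \<le> (2 * K + 1) * (2 * K)" using K sum by (intro mult_left_mono) auto
  then have "\<bar>2 * (N * z)\<bar> \<le> (2 * K + 1) * (2 * K) + 2 * K"
    unfolding eq using sum(2) K abs_mult[of "2 * K + 1" "x + y"] by linarith
  also have "\<dots> < 2 * N" unfolding N_def by (simp add: power2_eq_square algebra_simps)
  finally have "\<bar>N * z\<bar> < N" by simp
  moreover have "N * 1 \<le> N * \<bar>z\<bar>" if "z \<noteq> 0"
    using that K by (intro mult_left_mono) (auto simp: N_def)
  moreover have "\<bar>N * z\<bar> = N * \<bar>z\<bar>" using K by (simp add: abs_mult N_def)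
  ultimately have "z = 0" by (cases "z = 0") simp_all
  then have eq': "(2 * K + 1) * (x + y) = x - y" using eq by simp
  have "x + y = 0"
  proof (rule ccontr)
    assume "x + y \<noteq> 0"
    then have "(2 * K + 1) * 1 \<le> (2 * K + 1) * \<bar>x + y\<bar>" using K by (intro mult_left_mono) auto
    also have "\<dots> = \<bar>(2 * K + 1) * (x + y)\<bar>" using K by (simp add: abs_mult)
    also have "\<dots> \<le> 2 * K" unfolding eq' by (rule sum)
    finally show False by simp
  qed
  with eq' show ?thesis by simp
qed

text \<open>The form \<open>K * x + (K + 1) * y\<close> is divisible by \<open>N\<close> exactly on
  the lattice. So it suffices to find a displacement in the ball for each residue \<open>s'\<close>
  of this form, taken symmetrically around 0.\<close>

lemma lattice_covers:
  fixes K :: int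
  assumes K: "0 \<le> K"
  obtains c z where "\<bar>(2 * K + 1) * c + (2 * K\<^sup>2 + 2 * K + 1) * z - x\<bar> + \<bar>c - y\<bar> \<le> K"
proof -
  define N where "N = 2 * K\<^sup>2 + 2 * K + 1"
  define s where "s = K * x + (K + 1) * y"
  define h where "h = K\<^sup>2 + K"
  have h: "0 \<le> h" "N = 2 * h + 1" using K by (auto simp: h_def N_def)
  define w where "w = (s + h) div N"
  define s' where "s' = (s + h) mod N - h"
  have s: "s = s' + N * w" unfolding s'_def w_def by (simp add: algebra_simps)
  have "0 < N" using h by simp
  then have "0 \<le> (s + h) mod N" "(s + h) mod N < N" by simp_all
  then have s'h: "\<bar>s'\<bar> \<le> h" using h(2) unfolding s'_def by linarith
  \<comment> \<open>\<open>i\<close> and \<open>l\<close> are to be the sum and the difference of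
    the displacement, related by \<open>2 * s' = (2 * K + 1) * i - l\<close>; rounding to the
    nearest integer keeps \<open>l\<close> small.\<close>
  define i where "i = (2 * s' + K) div (2 * K + 1)"
  define l where "l = (2 * K + 1) * i - 2 * s'"
  have "2 * s' + K = (2 * K + 1) * i + (2 * s' + K) mod (2 * K + 1)" unfolding i_def by simp
  moreover have "0 < 2 * K + 1" using K by simp
  then have "0 \<le> (2 * s' + K) mod (2 * K + 1)" "(2 * s' + K) mod (2 * K + 1) < 2 * K + 1"
    by (rule pos_mod_sign, rule pos_mod_bound)
  ultimately have l: "\<bar>l\<bar> \<le> K" unfolding l_def by linarith
  have i: "\<bar>i\<bar> \<le> K"
  proof (rule ccontr)
    assume "\<not> ?thesis"
    then have "(2 * K + 1) * (K + 1) \<le> (2 * K + 1) * \<bar>i\<bar>" using K by (intro mult_left_mono) auto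
    also have "\<dots> = \<bar>l + 2 * s'\<bar>" using K by (simp add: l_def abs_mult)
    also have "\<dots> \<le> K + 2 * h" using l s'h by linarith
    finally show False using K by (simp add: h_def power2_eq_square algebra_simps)
  qed
  define dy where "dy = s' - K * i"
  define dx where "dx = i - dy"
  have d: "\<bar>dx\<bar> + \<bar>dy\<bar> \<le> K"
  proof -
    have "dx + dy = i" "dx - dy = l" by (simp_all add: dx_def dy_def l_def algebra_simps)
    then show ?thesis using i l by linarith
  qed
  define c where "c = y - dy"
  define z where "z = x - dx + c - 2 * (K + 1) * w"
  have "K * (x - dx) + (K + 1) * c = s - (K * i + dy)"
    by (simp add: s_def c_def dx_def algebra_simps)
  then have c: "K * (x - dx) + (K + 1) * c = N * w" using s by (simp add: dy_def)
  have "(2 * K + 1) * c + N * z = (x - dx) +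
      (2 * (K + 1) * (K * (x - dx) + (K + 1) * c) - 2 * (K + 1) * (N * w))"
    unfolding z_def N_def by (simp add: power2_eq_square algebra_simps)
  then have "(2 * K + 1) * c + N * z = x - dx" using c by simp
  then have "\<bar>(2 * K + 1) * c + N * z - x\<bar> + \<bar>c - y\<bar> \<le> K" using d by (simp add: c_def)
  then show thesis using that unfolding N_def by blast
qed

text \<open>Balls of radius \<open>k\<close> around the lattice points tile the plane. Those with centres in the rows
  \<open>1 - k, \<dots>, n + k\<close> cover the grid, and there are \<open>n + 2 * k\<close> of them in every
  \<open>2 * k\<^sup>2 + 2 * k + 1\<close> consecutive columns, one per row. They are enumerated by column.\<close>

locale sweep =
  fixes n k m :: nat
  assumes enough: "n + 2 * k + 1 \<le> m * (2 * k\<^sup>2 + 2 * k + 1)" and n: "0 < n"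
begin

definition K :: int where "K = int k"
definition N :: int where "N = 2 * K\<^sup>2 + 2 * K + 1"
definition M :: int where "M = int n + 2 * K"

text \<open>The lattice points in row \<open>c\<close> are in the columns congruent to this residue
  modulo \<open>N\<close>.\<close>

definition row_offset :: "int \<Rightarrow> int" where "row_offset c = ((2 * K + 1) * c) mod N"

definition rows :: "int list" where "rows = sort_key row_offset [1 - K..int n + K]"

text \<open>A block of \<open>M\<close> indices visits each row once, ordered by offset, and the
  next block repeats this \<open>N\<close> columns further right.\<close>

definition tile :: "int \<Rightarrow> int \<times> int" where
  "tile j = (let c = rows ! nat (j mod M) in (N * (j div M) + row_offset c, c))"

lemma K: "0 \<le> K" and N: "0 < N" and M: "0 < M"
  using n by (auto simp: K_def N_def M_def add_nonneg_pos)

lemma set_rows: "set rows = {1 - K..int n + K}" and length_rows: "int (length rows) = M"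
  using K by (auto simp: rows_def M_def)

lemma index: "0 \<le> j mod M" "nat (j mod M) < length rows"
  using M length_rows by (auto simp: nat_less_iff)

lemma fst_tile: "fst (tile j) = N * (j div M) + row_offset (snd (tile j))"
  by (simp add: tile_def Let_def)

lemma row_offset: "0 \<le> row_offset c" "row_offset c < N"
  using N by (simp_all add: row_offset_def)

lemma tile_mono:
  assumes "i \<le> j"
  shows "fst (tile i) \<le> fst (tile j)"
proof (cases "i div M = j div M")
  case True
  have "sorted (map row_offset rows)" by (simp add: rows_def)
  moreover have "i mod M \<le> j mod M" using assms True minus_mult_div_eq_mod[of i M] minus_mult_div_eq_mod[of j M] by simp
  ultimately have "map row_offset rows ! nat (i mod M) \<le> map row_offset rows ! nat (j mod M)"
    using index by (intro sorted_nth_mono) (auto simp: nat_mono)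
  then show ?thesis using True index by (simp add: tile_def Let_def)
next
  case False
  then have "i div M + 1 \<le> j div M" using assms M zdiv_mono1[of i j M] by simp
  then have "N * (i div M + 1) \<le> N * (j div M)" using N by (intro mult_left_mono) auto
  then show ?thesis using row_offset[of "snd (tile i)"] row_offset[of "snd (tile j)"]
    by (simp add: fst_tile algebra_simps)
qed

lemma tile_surj:
  assumes "c \<in> {1 - K..int n + K}"
  obtains j where "tile j = ((2 * K + 1) * c + N * z, c)"
proof -
  obtain a where a: "a < length rows" "rows ! a = c"
    using assms set_rows by (metis in_set_conv_nth)
  define q where "q = z + ((2 * K + 1) * c) div N"
  have "int a < M" using a(1) length_rows by simp
  then have "(M * q + int a) div M = q" "(M * q + int a) mod M = int a" using M by simp_all
  then have "tile (M * q + int a) = (N * q + row_offset c, c)" using a(2) by (simp add: tile_def)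
  moreover have "N * q + row_offset c = (2 * K + 1) * c + N * z"
    unfolding q_def row_offset_def by (simp add: algebra_simps)
  ultimately show thesis using that by simp
qed

lemma tile_separated:
  assumes "zdist (tile i) (tile j) \<le> 2 * K"
  shows "tile i = tile j"
proof -
  obtain a b where i: "tile i = (a, b)" by (cases "tile i")
  obtain a' b' where j: "tile j = (a', b')" by (cases "tile j")
  let ?f = "\<lambda>c. (2 * K + 1) * c"
  have mod: "row_offset c = ?f c - N * (?f c div N)" for c
    unfolding row_offset_def by (simp add: minus_mult_div_eq_mod)
  have "a = ?f b + N * (i div M - ?f b div N)" "a' = ?f b' + N * (j div M - ?f b' div N)"
    using fst_tile[of i] fst_tile[of j] i j mod by (simp_all add: algebra_simps)
  then have "a - a' = ?f (b - b') + N * ((i div M - ?f b div N) - (j div M - ?f b' div N))"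
    by (simp add: algebra_simps)
  from lattice_separated[OF K this[unfolded N_def]] assms show ?thesis
    by (simp add: i j)
qed

lemma tile_covers:
  assumes "y \<in> {1..int n}"
  obtains j where "zdist (tile j) (x, y) \<le> K"
proof -
  obtain c z where c: "\<bar>(2 * K + 1) * c + N * z - x\<bar> + \<bar>c - y\<bar> \<le> K"
    using lattice_covers[OF K] unfolding N_def by metis
  then have "c \<in> {1 - K..int n + K}" using assms by auto
  then obtain j where "tile j = ((2 * K + 1) * c + N * z, c)" by (rule tile_surj)
  with c have "zdist (tile j) (x, y) \<le> K" by simp
  then show thesis by (rule that)
qed

text \<open>The cops process \<open>m\<close> tiles per round, in a frame of reference in which everything is shifted to
  the right by one in each round. In this frame a move never leads to a tile in an earlier column,
  so an unseen robber stays in unprocessed tiles.\<close>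

definition unprocessed :: "nat \<Rightarrow> (int \<times> int) set" where
  "unprocessed t = {p \<in> zbox n. \<exists>j\<ge>int m * int t - 2 * M. zdist (tile j) (fst p + int t, snd p) \<le> K}"

text \<open>Tiles meeting the grid at time 0 have block index \<open>j div M\<close> at least -1, so
  the start at \<open>- 2 * M\<close> skips none.\<close>

lemma unprocessed_0: "unprocessed 0 = zbox n"
proof -
  have "p \<in> unprocessed 0" if p: "p \<in> zbox n" for p
  proof -
    obtain x y where xy: "p = (x, y)" by (cases p)
    have y: "y \<in> {1..int n}" "1 \<le> x" using p by (auto simp: zbox_def xy)
    obtain j where j: "zdist (tile j) (x, y) \<le> K" using tile_covers[OF y(1)] by blast
    then have "1 - K \<le> fst (tile j)" using y(2) by (cases "tile j") auto
    then have "1 - K < N * (j div M) + N" using row_offset[of "snd (tile j)"] unfolding fst_tile by linarith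
    moreover have "K \<le> N" using K by (simp add: N_def)
    ultimately have "0 < N * (j div M + 2)" by (simp add: algebra_simps)
    then have "- 1 \<le> j div M" using N by (simp add: zero_less_mult_iff)
    then have "M * (- 1) \<le> M * (j div M)" using M by (intro mult_left_mono) auto
    also have "\<dots> \<le> j" using M index(1)[of j] minus_mult_div_eq_mod[of j M] by linarith
    finally have "- 2 * M \<le> j" using M by simp
    with p j show ?thesis by (auto simp: unprocessed_def xy)
  qed
  then show ?thesis by (auto simp: unprocessed_def)
qed

text \<open>Per round the front advances on average by \<open>m * N / M\<close>, at least
  \<open>1 + 1 / M\<close> columns, and the grid by one. In \<open>T\<close> rounds the gain exceeds
  \<open>n + K\<close> plus \<open>3 * N\<close> columns for the start at \<open>- 2 * M\<close> and
  for rounding.\<close>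

lemma unprocessed_final: "\<exists>T. unprocessed T = {}"
proof -
  define T where "T = nat (M * (int n + K + 3 * N) + 1)"
  have T: "int T = M * (int n + K + 3 * N) + 1" using M K N by (simp add: T_def)
  have "False" if p: "p \<in> unprocessed T" for p
  proof -
    obtain j where j: "int m * int T - 2 * M \<le> j" "zdist (tile j) (fst p + int T, snd p) \<le> K"
      and box: "p \<in> zbox n"
      using p by (auto simp: unprocessed_def)
    have "fst (tile j) \<le> int n + int T + K" using j(2) box by (cases "tile j") (auto simp: zbox_def)
    then have "N * (j div M) \<le> int n + int T + K" using row_offset[of "snd (tile j)"] unfolding fst_tile by linarith
    then have "M * (N * (j div M)) \<le> M * (int n + int T + K)" using M by (intro mult_left_mono) auto
    moreover have "int m * int T - 3 * M \<le> M * (j div M)"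
      using j(1) M minus_mult_div_eq_mod[of j M] pos_mod_bound[of M j] by linarith
    then have "N * (int m * int T - 3 * M) \<le> N * (M * (j div M))" using N by (intro mult_left_mono) auto
    moreover have "(M + 1) * int T \<le> (int m * N) * int T"
    proof (rule mult_right_mono)
      have "int (n + 2 * k + 1) \<le> int (m * (2 * k\<^sup>2 + 2 * k + 1))" using enough by (rule of_nat_mono)
      then show "M + 1 \<le> int m * N" by (simp add: M_def N_def K_def algebra_simps)
    qed simp
    ultimately have "int T \<le> M * (int n + K + 3 * N)" by (simp add: algebra_simps)
    then show False using T by simp
  qed
  then show ?thesis by blast
qed

lemma localizable_unprocessed:
  assumes seen: "\<And>u. localizable (zbox n) k m (reach (zbox n) (zball (int k) u))"
    and "localizable (zbox n) k m (unprocessed (Suc t))"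
  shows "localizable (zbox n) k m (unprocessed t)"
proof -
  define first where "first = int m * int t - 2 * M"
  \<comment> \<open>The tiles live in the moving frame, so their centres are translated back by
    \<open>t\<close> columns.\<close>
  define U where "U = map (\<lambda>i. shift (- int t, 0) (tile (first + int i))) [0..<m]"
  have sub: "reach (zbox n) {x \<in> unprocessed t. \<forall>u\<in>set U. int k < zdist u x} \<subseteq> unprocessed (Suc t)"
  proof
    fix q assume "q \<in> reach (zbox n) {x \<in> unprocessed t. \<forall>u\<in>set U. int k < zdist u x}"
    then obtain p where p: "p \<in> unprocessed t" "\<And>u. u \<in> set U \<Longrightarrow> K < zdist u p"
      and pq: "zdist p q \<le> 1" and q: "q \<in> zbox n"
      by (auto simp: reach_def K_def)
    obtain j where j: "first \<le> j" "zdist (tile j) (fst p + int t, snd p) \<le> K"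
      using p(1) by (auto simp: unprocessed_def first_def)
    have "first + int m \<le> j"
    proof (rule ccontr)
      assume "\<not> ?thesis"
      then have i: "nat (j - first) < m" "first + int (nat (j - first)) = j" using j(1) by simp_all
      have "shift (- int t, 0) (tile (first + int (nat (j - first)))) \<in> set U"
        unfolding U_def set_map using i(1) by (intro imageI) simp
      with p(2) have "K < zdist (shift (- int t, 0) (tile j)) p" unfolding i(2) by blast
      then show False using j(2) by (cases "tile j"; cases p) (auto simp: shift_def)
    qed
    have "snd q \<in> {1..int n}" using q by (auto simp: zbox_def)
    then obtain j' where j': "zdist (tile j') (fst q + int t + 1, snd q) \<le> K"
      by (rule tile_covers)
    have "\<exists>i\<ge>first + int m. zdist (tile i) (fst q + int t + 1, snd q) \<le> K"
    proof (cases "first + int m \<le> j'")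
      case False
      then have "fst (tile j') \<le> fst (tile j)" using \<open>first + int m \<le> j\<close> by (intro tile_mono) simp
      \<comment> \<open>In the moving frame the rightward part of a move is at least its vertical
        part, so a move towards a tile not further right adds nothing to the two radii.\<close>
      then have "zdist (tile j') (tile j) \<le> 2 * K"
        using j(2) j' pq by (cases p; cases q; cases "tile j"; cases "tile j'") simp
      then have "tile j' = tile j" by (rule tile_separated)
      with j' \<open>first + int m \<le> j\<close> show ?thesis by auto
    qed (use j' in blast)
    with q show "q \<in> unprocessed (Suc t)"
      by (auto simp: unprocessed_def first_def algebra_simps)
  qed
  show ?thesis
  proof (rule localizable_blind[where U = U and r = "int k", OF _ order_refl seen])
    show "length U \<le> m" by (simp add: U_def)
    show "localizable (zbox n) k m (reach (zbox n) {x \<in> unprocessed t. \<forall>u\<in>set U. int k < zdist u x})"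
      by (rule localizable_mono[OF assms(2) order_refl order_refl order_refl sub])
  qed
qed

lemma localizable_zbox:
  assumes "\<And>u. localizable (zbox n) k m (reach (zbox n) (zball (int k) u))"
  shows "localizable (zbox n) k m (zbox n)"
proof -
  obtain T where T: "unprocessed T = {}" using unprocessed_final by blast
  have "localizable (zbox n) k m (unprocessed t)" if "t \<le> T" for t
    using that
  proof (induction rule: inc_induct)
    case base
    then show ?case by (simp add: T localizable_empty)
  next
    case (step t)
    then show ?case using localizable_unprocessed assms by blast
  qed
  from this[of 0] show ?thesis by (simp add: unprocessed_0)
qed

end

lemma cops_win_if_enough:
  assumes "n + 2 * k + 1 \<le> m * (2 * k\<^sup>2 + 2 * k + 1)" "0 < n"
    and "k = 1 \<and> 3 \<le> m \<or> 2 \<le> k \<and> 2 \<le> m"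
  shows "cops_win (grid_graph n) k m"
proof -
  interpret sweep n k m using assms(1,2) by unfold_locales
  show ?thesis
    using cops_win_if_localizable localizable_zbox localizable_zbox_seen assms(2,3) by blast
qed

section \<open>Arithmetic of the ceiling and conclusion\<close>

lemma ceiling_div_nat:
  assumes "0 < b"
  shows "\<lceil>real a / real b\<rceil> = int ((a + b - 1) div b)"
proof -
  define c where "c = (a + b - 1) div b"
  have "a + b - 1 = c * b + (a + b - 1) mod b" "(a + b - 1) mod b < b" using assms by (simp_all add: c_def)
  then have "a \<le> c * b" "c * b < a + b" using assms by linarith+
  then have "real a \<le> real c * real b" "real c * real b < real a + real b"
    by (simp_all flip: of_nat_mult of_nat_add)
  then have "real c - 1 < real a / real b" "real a / real b \<le> real c"
    using assms by (simp_all add: field_simps)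
  then show ?thesis unfolding c_def[symmetric] by (intro ceiling_unique) simp_all
qed

theorem theorem18:
  fixes n k :: nat
  assumes "0 < n" and "0 < k"
    and "2 \<le> k \<Longrightarrow> 2 * k\<^sup>2 + 2 * k + 1 \<le> n"
    and "k = 1 \<Longrightarrow> 10 \<le> n"
  shows "(n mod (2 * k\<^sup>2 + 2 * k + 1) \<in> {1..2 * k\<^sup>2} \<longrightarrow>
      int (localization_number k (grid_graph n))
        = \<lceil>real n / real (2 * k\<^sup>2 + 2 * k + 1)\<rceil>) \<and>
    (n mod (2 * k\<^sup>2 + 2 * k + 1) \<notin> {1..2 * k\<^sup>2} \<longrightarrow>
      int (localization_number k (grid_graph n))
        \<in> {\<lceil>real n / real (2 * k\<^sup>2 + 2 * k + 1)\<rceil>,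
            \<lceil>real n / real (2 * k\<^sup>2 + 2 * k + 1)\<rceil> + 1})"
proof -
  define N where "N = 2 * k\<^sup>2 + 2 * k + 1"
  define C where "C = (n + N - 1) div N"
  define q r where "q = n div N" and "r = n mod N"
  let ?G = "grid_graph n"
  have N0: "0 < N" by (simp add: N_def)
  have nqr: "n = q * N + r" "r < N" using N0 by (simp_all add: q_def r_def)
  have C_eq: "C = (if r = 0 then q else q + 1)"
  proof -
    have "n + N - 1 = q * N + (r + N - 1)" using nqr(1) N0 by simp
    then have "C = q + (r + N - 1) div N" unfolding C_def using N0 by (simp only: div_mult_self3 neq0_conv)
    moreover have "(r + N - 1) div N = (if r = 0 then 0 else 1)"
      using nqr(2) by (auto simp: div_nat_eqI)
    ultimately show ?thesis by simp
  qed
  have ceil: "\<lceil>real n / real N\<rceil> = int C" unfolding C_def using N0 by (rule ceiling_div_nat)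
  \<comment> \<open>This guarantees at least two cops, and three for \<open>k = 1\<close>, whenever
    \<open>q + 1\<close> are available.\<close>
  have q: "1 \<le> q" "k = 1 \<Longrightarrow> 2 \<le> q"
  proof -
    show two: "2 \<le> q" if "k = 1"
    proof -
      have "N * 2 \<le> n" using assms(4)[OF that] that by (simp add: N_def)
      then show ?thesis using N0 by (simp add: q_def less_eq_div_iff_mult_less_eq mult.commute)
    qed
    show "1 \<le> q"
    proof (cases "k = 1")
      case False
      then have "N \<le> n" using assms(2,3) by (simp add: N_def)
      then show ?thesis using N0 by (simp add: q_def less_eq_div_iff_mult_less_eq)
    qed (use two in simp)
  qed
  have n3: "3 \<le> n"
  proof (cases "k = 1")
    case False
    then have "2 * k + 1 \<le> n" "2 \<le> k" using assms(2,3) by simp_all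
    then show ?thesis by simp
  qed (use assms(4) in simp)
  have lower: "C \<le> m" if "cops_win ?G k m" for m
  proof (rule ccontr)
    assume "\<not> ?thesis"
    then have m: "m \<le> q" "r = 0 \<Longrightarrow> m + 1 \<le> q" unfolding C_eq by (auto split: if_splits)
    have "m * N < n"
    proof (cases "r = 0")
      case True
      then have "m * N < q * N" using m N0 by (intro mult_less_mono1) simp_all
      with nqr True show ?thesis by simp
    next
      case False
      have "m * N \<le> q * N" using m by (intro mult_le_mono1)
      also have "\<dots> < n" using nqr False by simp
      finally show ?thesis .
    qed
    with not_cops_win[of m k n] n3 that show False by (simp add: N_def)
  qed
  have number: "C \<le> localization_number k ?G \<and> localization_number k ?G \<le> m"
    if "cops_win ?G k m" "0 < m" for m
    using LeastI[of "\<lambda>m. 0 < m \<and> cops_win ?G k m" m] Least_le[of "\<lambda>m. 0 < m \<and> cops_win ?G k m" m]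
      that lower unfolding localization_number_def by blast
  have k: "k = 1 \<or> 2 \<le> k" using assms(2) by linarith
  have "localization_number k ?G = C" if "r \<in> {1..2 * k\<^sup>2}"
  proof -
    have C: "C = q + 1" using that C_eq by auto
    \<comment> \<open>The condition \<open>r \<le> 2 * k\<^sup>2\<close> leaves exactly the slack
      \<open>2 * k + 1\<close> that the sweep requires.\<close>
    have "n + 2 * k + 1 \<le> C * N" using nqr(1) that unfolding C by (simp add: N_def)
    then have "cops_win ?G k C"
      using cops_win_if_enough[of n k C] assms(1) k q C unfolding N_def by auto
    then show ?thesis using number[of C] C by simp
  qed
  moreover have "localization_number k ?G \<in> {C, C + 1}"
  proof -
    have C: "q \<le> C" unfolding C_eq by simp
    have "n \<le> C * N" using nqr unfolding C_eq by simp
    then have "n + 2 * k + 1 \<le> (C + 1) * N" by (simp add: N_def)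
    then have "cops_win ?G k (C + 1)"
      using cops_win_if_enough[of n k "C + 1"] assms(1) k q C unfolding N_def by auto
    from number[OF this] show ?thesis by auto
  qed
  ultimately show ?thesis
    unfolding N_def[symmetric] r_def[symmetric] ceil by auto
qed

end
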